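(* Let $\Omega$ be a finite set with $|\Omega|=n$, let $(H_i\mid i\in\Omega)$ be finite abelian groups with $h_i:=|H_i|\geqslant 2$ for all $i\in\Omega$, let $\mathbf{H}=\prod_{i\in\Omega}H_i$, and let $\mathbf{P}=(\Omega,\preccurlyeq_{\mathbf{P}})$ be a poset. Let $\Lambda$ be the dual partition of $\mathcal{Q}(\mathbf{H},\mathbf{P})$. Then the following are equivalent: (1) $\mathcal{Q}(\mathbf{H},\mathbf{P})$ is Fourier-reflexive; (2) $\Lambda=\mathcal{Q}(\hat{\mathbf{H}},\overline{\mathbf{P}})$; (3) $\mathbf{P}$ is hierarchical, and for any $u,v\in\Omega$ with $\mathrm{len}(u)=\mathrm{len}(v)$ we have $h_u=h_v$.
   Context: For a finite abelian group $H$, $\hat H$ is its character group (homomorphisms $H\to\mathbb{C}^*$). We identify $\hat{\mathbf{H}}$ with $\prod_{i\in\Omega}\hat{H_i}$ via $\alpha(\beta)=\prod_{i\in\Omega}\alpha_{(i)}(\beta_{(i)})$, and identify $\hat{\hat{H}}$ with $H$ canonically. For $\beta\in\mathbf{H}$, $\mathrm{supp}(\beta)=\{i\in\Omega:\beta_{(i)}\neq 1_{H_i}\}$; similarly for $\alpha\in\hat{\mathbf{H}}$, $\mathrm{supp}(\alpha)=\{i:\alpha_{(i)}\text{ is not the trivial character}\}$. For a poset $\mathbf{P}$ on $\Omega$ and $B\subseteq\Omega$, $\langle B\rangle_{\mathbf{P}}=\{a\in\Omega:\exists b\in B,\ a\preccurlyeq_{\mathbf{P}}b\}$. The $\mathbf{P}$-weight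 of a codeword is $\mathrm{wt}_{\mathbf{P}}(\beta)=|\langle\mathrm{supp}(\beta)\rangle_{\mathbf{P}}|$. $\mathcal{Q}(\mathbf{H},\mathbf{P})$ is the partition of $\mathbf{H}$ whose blocks are the sets of codewords of equal $\mathbf{P}$-weight; $\mathcal{Q}(\hat{\mathbf{H}},\overline{\mathbf{P}})$ is defined likewise on $\hat{\mathbf{H}}$ using the dual poset $\overline{\mathbf{P}}$ ($u\preccurlyeq_{\overline{\mathbf{P}}}v\iff v\preccurlyeq_{\mathbf{P}}u$). For a partition $\Gamma$ of a finite abelian group $H$, the dual partition $\widehat{\Gamma}$ is the partition of $\hat H$ with $\chi\sim\psi$ iff $\sum_{b\in B}\chi(b)=\sum_{b\in B}\psi(b)$ for all $B\in\Gamma$; the bidual partition $\widehat{\widehat{\Gamma}}$ is the partition of $H$ with $b\sim d$ iff $\sum_{\chi\in A}\chi(b)=\sum_{\chi\in A}\chi(d)$ for all $A\in\widehat\Gamma$. $\Gamma$ is Fourier-reflexive if $\widehat{\widehat{\Gamma}}=\Gamma$. For $y\in\Omega$, $\mathrm{len}(y)$ is the largest cardinality of a chain in $\mathbf{P}$ having $y$ as its greatest element. $\mathbf{P}$ is hierarchical if for all $u,v\in\Omega$ with $\mathrm{len}(u)+1\leqslant\mathrm{len}(v)$ we have $u\preccurlyeq_{\mathbf{P}}v$. *)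

theory Defs
  imports Complex_Main "HOL-Algebra.Group"
begin

text \<open>A character of G: a multiplicative map carrier G -> C-star; extended by 0 outside
the carrier so that characters are determined by their values on the carrier.\<close>
definition characters :: "('a, 'c) monoid_scheme \<Rightarrow> ('a \<Rightarrow> complex) set" where
  "characters G = {\<chi>. (\<forall>x\<in>carrier G. \<forall>y\<in>carrier G. \<chi> (x \<otimes>\<^bsub>G\<^esub> y) = \<chi> x * \<chi> y)
                     \<and> (\<forall>x\<in>carrier G. \<chi> x \<noteq> 0)
                     \<and> (\<forall>x. x \<notin> carrier G \<longrightarrow> \<chi> x = 0)}"

definition trivial_character :: "('a, 'c) monoid_scheme \<Rightarrow> 'a \<Rightarrow> complex" where
  "trivial_character G = (\<lambda>x. if x \<in> carrier G then 1 else 0)"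

definition prod_carrier :: "'i set \<Rightarrow> ('i \<Rightarrow> ('a, 'c) monoid_scheme) \<Rightarrow> ('i \<Rightarrow> 'a) set" where
  "prod_carrier \<Omega> H = (\<Pi>\<^sub>E i\<in>\<Omega>. carrier (H i))"

text \<open>Character group identified with the product of the character groups.\<close>
definition prod_chars :: "'i set \<Rightarrow> ('i \<Rightarrow> ('a, 'c) monoid_scheme) \<Rightarrow> ('i \<Rightarrow> 'a \<Rightarrow> complex) set" where
  "prod_chars \<Omega> H = (\<Pi>\<^sub>E i\<in>\<Omega>. characters (H i))"

definition char_eval :: "'i set \<Rightarrow> ('i \<Rightarrow> 'a \<Rightarrow> complex) \<Rightarrow> ('i \<Rightarrow> 'a) \<Rightarrow> complex" where
  "char_eval \<Omega> \<alpha> \<beta> = (\<Prod>i\<in>\<Omega>. \<alpha> i (\<beta> i))"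

definition supp_word :: "'i set \<Rightarrow> ('i \<Rightarrow> ('a, 'c) monoid_scheme) \<Rightarrow> ('i \<Rightarrow> 'a) \<Rightarrow> 'i set" where
  "supp_word \<Omega> H \<beta> = {i\<in>\<Omega>. \<beta> i \<noteq> \<one>\<^bsub>H i\<^esub>}"

definition supp_char :: "'i set \<Rightarrow> ('i \<Rightarrow> ('a, 'c) monoid_scheme) \<Rightarrow> ('i \<Rightarrow> 'a \<Rightarrow> complex) \<Rightarrow> 'i set" where
  "supp_char \<Omega> H \<alpha> = {i\<in>\<Omega>. \<alpha> i \<noteq> trivial_character (H i)}"

text \<open>A poset on \<Omega> is a relation r with partial_order_on \<Omega> r; (a,b) \<in> r means a \<preccurlyeq> b.
  The dual poset is converse r.\<close>

definition ideal :: "'i set \<Rightarrow> ('i \<times> 'i) set \<Rightarrow> 'i set \<Rightarrow> 'i set" where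
  "ideal \<Omega> r B = {a\<in>\<Omega>. \<exists>b\<in>B. (a, b) \<in> r}"

definition weight_partition :: "'x set \<Rightarrow> ('x \<Rightarrow> 'i set) \<Rightarrow> 'i set \<Rightarrow> ('i \<times> 'i) set \<Rightarrow> 'x set set" where
  "weight_partition X supp \<Omega> r =
     X // {(x, y). x \<in> X \<and> y \<in> X \<and> card (ideal \<Omega> r (supp x)) = card (ideal \<Omega> r (supp y))}"

definition chain_len :: "'i set \<Rightarrow> ('i \<times> 'i) set \<Rightarrow> 'i \<Rightarrow> nat" where
  "chain_len \<Omega> r y = Max {card C | C. C \<subseteq> \<Omega> \<and> y \<in> C \<and> (\<forall>c\<in>C. (c, y) \<in> r)
                              \<and> (\<forall>a\<in>C. \<forall>b\<in>C. (a, b) \<in> r \<or> (b, a) \<in> r)}"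

definition hierarchical :: "'i set \<Rightarrow> ('i \<times> 'i) set \<Rightarrow> bool" where
  "hierarchical \<Omega> r \<longleftrightarrow> (\<forall>u\<in>\<Omega>. \<forall>v\<in>\<Omega>. chain_len \<Omega> r u + 1 \<le> chain_len \<Omega> r v \<longrightarrow> (u, v) \<in> r)"

definition dual_partition :: "'x set \<Rightarrow> ('x \<Rightarrow> 'y \<Rightarrow> complex) \<Rightarrow> 'y set set \<Rightarrow> 'x set set" where
  "dual_partition X e \<Gamma> =
     X // {(x, x'). x \<in> X \<and> x' \<in> X \<and> (\<forall>B\<in>\<Gamma>. (\<Sum>b\<in>B. e x b) = (\<Sum>b\<in>B. e x' b))}"

definition Q_words :: "'i set \<Rightarrow> ('i \<Rightarrow> ('a, 'c) monoid_scheme) \<Rightarrow> ('i \<times> 'i) set \<Rightarrow> ('i \<Rightarrow> 'a) set set" where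
  "Q_words \<Omega> H r = weight_partition (prod_carrier \<Omega> H) (supp_word \<Omega> H) \<Omega> r"

definition Q_chars :: "'i set \<Rightarrow> ('i \<Rightarrow> ('a, 'c) monoid_scheme) \<Rightarrow> ('i \<times> 'i) set \<Rightarrow> ('i \<Rightarrow> 'a \<Rightarrow> complex) set set" where
  "Q_chars \<Omega> H r = weight_partition (prod_chars \<Omega> H) (supp_char \<Omega> H) \<Omega> r"

definition dual_of_words :: "'i set \<Rightarrow> ('i \<Rightarrow> ('a, 'c) monoid_scheme) \<Rightarrow> ('i \<Rightarrow> 'a) set set \<Rightarrow> ('i \<Rightarrow> 'a \<Rightarrow> complex) set set" where
  "dual_of_words \<Omega> H \<Gamma> = dual_partition (prod_chars \<Omega> H) (char_eval \<Omega>) \<Gamma>"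

text \<open>Dual partition of a partition of the character group (on the group, via bidual identification).\<close>
definition dual_of_chars :: "'i set \<Rightarrow> ('i \<Rightarrow> ('a, 'c) monoid_scheme) \<Rightarrow> ('i \<Rightarrow> 'a \<Rightarrow> complex) set set \<Rightarrow> ('i \<Rightarrow> 'a) set set" where
  "dual_of_chars \<Omega> H A = dual_partition (prod_carrier \<Omega> H) (\<lambda>\<beta> \<alpha>. char_eval \<Omega> \<alpha> \<beta>) A"

definition fourier_reflexive :: "'i set \<Rightarrow> ('i \<Rightarrow> ('a, 'c) monoid_scheme) \<Rightarrow> ('i \<Rightarrow> 'a) set set \<Rightarrow> bool" where
  "fourier_reflexive \<Omega> H \<Gamma> \<longleftrightarrow> dual_of_chars \<Omega> H (dual_of_words \<Omega> H \<Gamma>) = \<Gamma>"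

end

theory Submission
  imports Defs "HOL-Library.Function_Algebras"
begin

text \<open>
  All partitions involved are the kernels of functions. The Fourier transforms of the indicators of
  the weight classes are linearly independent, and both weight partitions have exactly
  |\<Omega>| + 1 blocks, so as soon as these transforms are constant on the dual weight classes they form
  a basis of the functions of the dual weight. By Fourier inversion each of the two weight
  partitions is then the dual of the other; this gives (2) \<Longrightarrow> (1).

  For (3) \<Longrightarrow> (2) it remains to see that the transforms are constant on the dual weight classes. The
  words of weight k are grouped by the ideal that they generate. The transform of a group is a
  product that vanishes at a character unless the support of the character meets the ideal in
  maximal elements only, so that only the lowest level of the support matters, and a
  level-preserving permutation exchanges any two supports of the same dual weight.

  For (1) \<Longrightarrow> (3) note that in the reflexive case the functions of the weight are closed under
  convolution. Assume that all elements outside the lowest l levels D lie above all of D. A word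
  whose weight is |D| + 1 is carried by D and one minimal element i of the complement of D. For a
  word \<gamma> generating an ideal K not contained in D, the number of such words that move \<gamma> to weight
  |K| + 1 is the order of the product of the groups over D times the sum of the |H_i| - 1 over the
  i outside K, and it depends on |K| only. Comparing ideals of equal size shows that the next level
  is dominated as well and that the orders of its groups agree.
\<close>

section \<open>Characters of finite abelian groups\<close>

text \<open>Values outside \<open>K\<close> are left free, so that a character of a subgroup can be
  extended in stages; the value 0 off the carrier is imposed only at the end.\<close>

definition character_on :: "('a, 'c) monoid_scheme \<Rightarrow> 'a set \<Rightarrow> ('a \<Rightarrow> complex) \<Rightarrow> bool" where
  "character_on G K \<chi> \<longleftrightarrow>
     (\<forall>x\<in>K. \<forall>y\<in>K. \<chi> (x \<otimes>\<^bsub>G\<^esub> y) = \<chi> x * \<chi> y) \<and> (\<forall>x\<in>K. \<chi> x \<noteq> 0)"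

context comm_group
begin

section \<open>Extending characters from subgroups\<close>

lemma finite_ex_pow_eq_one:
  assumes "finite (carrier G)" and a: "a \<in> carrier G"
  obtains n :: nat where "n > 0" "a [^] n = \<one>"
proof -
  have "\<not> inj_on (\<lambda>n::nat. a [^] n) UNIV"
    using assms finite_imageD[of "\<lambda>n::nat. a [^] n" UNIV] finite_subset[of _ "carrier G"]
    by (metis image_subsetI infinite_UNIV_nat nat_pow_closed)
  then obtain i j :: nat where ij: "i < j" "a [^] i = a [^] j"
    unfolding inj_on_def by (metis linorder_neqE_nat)
  then have "a [^] i \<otimes> a [^] (j - i) = a [^] i \<otimes> \<one>"
    using a nat_pow_mult[OF a, of i "j - i"] by simp
  then have "a [^] (j - i) = \<one>"
    using l_cancel_one'[of "a [^] i" "a [^] (j - i)"] a by simp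
  with ij that show thesis by (meson zero_less_diff)
qed

lemma int_pow_in_subgroup:
  assumes K: "subgroup K G" and x: "x \<in> K"
  shows "x [^] (i::int) \<in> K"
proof -
  interpret S: group "G\<lparr>carrier := K\<rparr>" using K by (rule subgroup_imp_group)
  show ?thesis using S.int_pow_closed[of x i] x int_pow_consistent[OF K x, of i] by simp
qed

lemma character_on_int_pow:
  assumes K: "subgroup K G" and \<chi>: "character_on G K \<chi>" and x: "x \<in> K"
  shows "\<chi> (x [^] (i::int)) = \<chi> x powi i"
proof -
  have xG: "x \<in> carrier G" using K x subgroup.mem_carrier by fast
  have pow: "x [^] j \<in> K" for j :: int
    using K x int_pow_in_subgroup by blast
  have nz: "\<chi> x \<noteq> 0" and mult: "\<And>x y. x \<in> K \<Longrightarrow> y \<in> K \<Longrightarrow> \<chi> (x \<otimes> y) = \<chi> x * \<chi> y"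
    using \<chi> x by (auto simp: character_on_def)
  have step: "\<chi> (x [^] (j + 1)) = \<chi> (x [^] j) * \<chi> x" for j :: int
    using mult[OF pow x, of j] xG by (simp add: int_pow_mult)
  have one: "\<chi> \<one> = 1"
  proof -
    have "\<chi> \<one> * \<chi> x = 1 * \<chi> x"
      using mult[of \<one> x] x xG subgroup.one_closed[OF K] by simp
    then show ?thesis using nz by simp
  qed
  show ?thesis
  proof (induction i rule: int_induct[where k = 0])
    case base then show ?case using one by simp
  next
    case (step1 j) then show ?case using step[of j] nz by (simp add: power_int_add)
  next
    case (step2 j) then show ?case using step[of "j - 1"] nz by (simp add: power_int_diff field_simps)
  qed
qed

text \<open>The extension to the subgroup generated by \<open>K\<close> and \<open>a\<close> sends
  \<open>k \<otimes> a [^] i\<close> to \<open>\<chi> k * z powi i\<close>. This is well defined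
  because \<open>a [^] i\<close> lies in \<open>K\<close> only if \<open>m\<close> divides
  \<open>i\<close>, and \<open>z\<close> is an \<open>m\<close>-th root of the value already fixed
  at \<open>a [^] m\<close>. The free choice of \<open>z\<close> is what later separates
  points.\<close>

lemma extend_character_on:
  fixes m :: nat
  assumes K: "subgroup K G" and \<chi>: "character_on G K \<chi>" and a: "a \<in> carrier G"
    and m: "m > 0" "a [^] m \<in> K" "\<And>j. 0 < j \<Longrightarrow> j < m \<Longrightarrow> a [^] j \<notin> K"
    and z: "z ^ m = \<chi> (a [^] m)"
  obtains K' \<chi>' where "subgroup K' G" "K \<subseteq> K'" "a \<in> K'" "character_on G K' \<chi>'"
    "\<And>x. x \<in> K \<Longrightarrow> \<chi>' x = \<chi> x" "\<chi>' a = z"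
proof -
  have KG: "\<And>x. x \<in> K \<Longrightarrow> x \<in> carrier G" using K subgroup.mem_carrier by fast
  have mult: "\<And>x y. x \<in> K \<Longrightarrow> y \<in> K \<Longrightarrow> \<chi> (x \<otimes> y) = \<chi> x * \<chi> y"
    and nz: "\<And>x. x \<in> K \<Longrightarrow> \<chi> x \<noteq> 0"
    using \<chi> by (auto simp: character_on_def)
  have z0: "z \<noteq> 0" using z nz[OF m(2)] m(1) by (metis power_0_left less_irrefl)
  have oneK: "\<one> \<in> K" using K subgroup.one_closed by fast
  have \<chi>1: "\<chi> \<one> = 1" using mult[OF oneK oneK] nz[OF oneK] by simp
  \<comment> \<open>The remainder \<open>t\<close> of \<open>i\<close> modulo \<open>m\<close>
    satisfies \<open>a [^] t \<in> K\<close>, so minimality of \<open>m\<close> forces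
    \<open>t = 0\<close>.\<close>
  have pow_in_K: "\<chi> (a [^] i) = z powi i" if i: "a [^] i \<in> K" for i :: int
  proof -
    define q t where "q = i div int m" and "t = nat (i mod int m)"
    have it: "i = int m * q + int t" and tm: "t < m"
      using m(1) by (auto simp: q_def t_def nat_less_iff)
    have mq: "a [^] (int m * q) = (a [^] m) [^] q"
      using int_pow_pow[OF a, of "int m" q] by (simp add: int_pow_int)
    have mqK: "(a [^] m) [^] q \<in> K" using K m(2) int_pow_in_subgroup by blast
    have "a [^] i = a [^] (int m * q) \<otimes> a [^] int t" unfolding it using a by (rule int_pow_mult)
    then have "a [^] int t = inv (a [^] (int m * q)) \<otimes> a [^] i"
      using inv_solve_left[of "a [^] int t" "a [^] (int m * q)" "a [^] i"] a by simp
    also have "\<dots> \<in> K" unfolding mq using K mqK i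
      by (meson subgroup.m_closed subgroup.m_inv_closed)
    finally have "a [^] t \<in> K" by (simp add: int_pow_int)
    then have "t = 0" using m(3) tm by blast
    then have "i = int m * q" using it by simp
    then show ?thesis
      using mq character_on_int_pow[OF K \<chi> m(2), of q] by (simp add: z[symmetric] power_int_mult)
  qed
  define K' where "K' = {k \<otimes> a [^] i | k (i::int). k \<in> K}"
  \<comment> \<open>Choice picks the value of one representation of \<open>y\<close>; the next fact
    shows that every representation gives the same value.\<close>
  define \<chi>' where "\<chi>' y = (SOME c. \<exists>k (i::int). k \<in> K \<and> y = k \<otimes> a [^] i \<and> c = \<chi> k * z powi i)" for y
  have \<chi>': "\<chi>' (k \<otimes> a [^] i) = \<chi> k * z powi i" if k: "k \<in> K" for k and i :: int
  proof -
    have "\<exists>k' (i'::int). k' \<in> K \<and> k \<otimes> a [^] i = k' \<otimes> a [^] i' \<and> \<chi>' (k \<otimes> a [^] i) = \<chi> k' * z powi i'"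
      unfolding \<chi>'_def by (rule someI_ex) (use k in blast)
    then obtain k' and i' :: int where k': "k' \<in> K" and eq: "k \<otimes> a [^] i = k' \<otimes> a [^] i'"
      and val: "\<chi>' (k \<otimes> a [^] i) = \<chi> k' * z powi i'" by blast
    \<comment> \<open>Two representations of one element differ by a power of \<open>a\<close> that
      lies in \<open>K\<close>, where \<open>pow_in_K\<close> applies.\<close>
    have "a [^] (i - i') = inv k \<otimes> k'"
    proof -
      have "k \<otimes> a [^] (i - i') = k \<otimes> a [^] i \<otimes> inv (a [^] i')"
        using a KG[OF k] by (simp add: int_pow_diff m_assoc)
      also have "\<dots> = k'" unfolding eq using a KG[OF k'] by (simp add: m_assoc)
      finally show ?thesis using inv_solve_left[of "a [^] (i - i')" k k'] a KG[OF k] KG[OF k'] by simp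
    qed
    moreover have ik: "inv k \<in> K" using K k subgroup.m_inv_closed by fast
    then have "inv k \<otimes> k' \<in> K" using K k' subgroup.m_closed by fast
    ultimately have "z powi (i - i') = \<chi> (inv k) * \<chi> k'"
      using pow_in_K[of "i - i'"] mult[OF ik k'] by simp
    moreover have "\<chi> k * \<chi> (inv k) = 1" using mult[OF k ik] KG[OF k] \<chi>1 by simp
    ultimately have "\<chi> k * z powi (i - i') = \<chi> k'" by (simp add: mult.assoc[symmetric])
    then show ?thesis using val z0 by (simp add: power_int_diff field_simps)
  qed
  have comb: "(k \<otimes> a [^] i) \<otimes> (k' \<otimes> a [^] i') = (k \<otimes> k') \<otimes> a [^] (i + i')"
    if "k \<in> K" "k' \<in> K" for k k' and i i' :: int
    using that KG a by (simp add: int_pow_mult m_ac)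
  show thesis
  proof
    show "subgroup K' G"
    proof (rule subgroupI)
      show "K' \<subseteq> carrier G" using KG a by (auto simp: K'_def)
      show "K' \<noteq> {}" using oneK by (auto simp: K'_def)
      show "inv x \<in> K'" if x: "x \<in> K'" for x
      proof -
        obtain k and i :: int where "k \<in> K" "x = k \<otimes> a [^] i" using x K'_def by blast
        then have "inv x = inv k \<otimes> a [^] (- i)" "inv k \<in> K"
          using KG a K by (auto simp: inv_mult int_pow_neg subgroup.m_inv_closed)
        then show ?thesis unfolding K'_def by blast
      qed
      show "x \<otimes> y \<in> K'" if x: "x \<in> K'" and y: "y \<in> K'" for x y
        using x y comb subgroup.m_closed[OF K] unfolding K'_def by blast
    qed
    show "K \<subseteq> K'"
    proof
      fix k assume "k \<in> K"
      then have "k = k \<otimes> a [^] (0::int)" using KG by simp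
      with \<open>k \<in> K\<close> show "k \<in> K'" unfolding K'_def by blast
    qed
    have a1: "a = \<one> \<otimes> a [^] (1::int)" using a by simp
    with oneK show "a \<in> K'" unfolding K'_def by blast
    show "character_on G K' \<chi>'"
      unfolding character_on_def
    proof safe
      fix x y assume "x \<in> K'" "y \<in> K'"
      then obtain k k' and i i' :: int
        where "k \<in> K" "k' \<in> K" "x = k \<otimes> a [^] i" "y = k' \<otimes> a [^] i'" unfolding K'_def by blast
      then show "\<chi>' (x \<otimes> y) = \<chi>' x * \<chi>' y"
        using comb \<chi>' mult subgroup.m_closed[OF K] z0 by (simp add: power_int_add)
    next
      fix x assume "x \<in> K'" "\<chi>' x = 0"
      then show False using \<chi>' nz z0 unfolding K'_def by fastforce
    qed
    show "\<chi>' x = \<chi> x" if "x \<in> K" for x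
      using \<chi>'[OF that, of 0] KG[OF that] by simp
    show "\<chi>' a = z" using \<chi>'[OF oneK, of 1] \<chi>1 a by simp
  qed
qed

text \<open>Nonzero complex numbers have roots of every order, so adjoining an element outside
  \<open>K\<close> meets no obstruction. The induction is on the number of elements missing from
  \<open>K\<close>.\<close>

lemma extend_character_on_carrier:
  assumes fin: "finite (carrier G)" and "subgroup K G" and "character_on G K \<chi>"
  shows "\<exists>\<chi>'. character_on G (carrier G) \<chi>' \<and> (\<forall>x\<in>K. \<chi>' x = \<chi> x)"
  using assms(2,3)
proof (induction "card (carrier G) - card K" arbitrary: K \<chi> rule: less_induct)
  case less
  have sub: "K \<subseteq> carrier G" using less.prems(1) subgroup.subset by blast
  show ?case
  proof (cases "K = carrier G")
    case True then show ?thesis using less.prems by auto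
  next
    case False
    then obtain a where a: "a \<in> carrier G" "a \<notin> K" using sub by blast
    define P where "P m \<longleftrightarrow> m > 0 \<and> a [^] m \<in> K" for m :: nat
    obtain n :: nat where "n > 0" "a [^] n = \<one>" using finite_ex_pow_eq_one[OF fin a(1)] .
    then have "P n" using subgroup.one_closed[OF less.prems(1)] by (simp add: P_def)
    then have P: "P (LEAST m. P m)" by (rule LeastI)
    define m where "m = (LEAST m. P m)"
    have m: "m > 0" "a [^] m \<in> K" "\<And>j. 0 < j \<Longrightarrow> j < m \<Longrightarrow> a [^] j \<notin> K"
      using P not_less_Least[of _ P] unfolding m_def[symmetric] by (auto simp: P_def)
    have "card {z::complex. z ^ m = \<chi> (a [^] m)} = m"
      using less.prems(2) m by (intro card_nth_roots) (auto simp: character_on_def)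
    then obtain z where z: "z ^ m = \<chi> (a [^] m)" using m(1)
      by (metis (mono_tags, lifting) card.empty empty_Collect_eq less_numeral_extra(3))
    obtain K' \<chi>' where K': "subgroup K' G" "K \<subseteq> K'" "a \<in> K'" "character_on G K' \<chi>'"
      "\<And>x. x \<in> K \<Longrightarrow> \<chi>' x = \<chi> x"
      using extend_character_on[OF less.prems a(1) m z] by metis
    have finK': "finite K'" and K'G: "K' \<subseteq> carrier G"
      using K'(1) subgroup.subset fin finite_subset by blast+
    have "card K < card K'" using K'(2,3) a(2) finK' by (intro psubset_card_mono) auto
    moreover have "card K' \<le> card (carrier G)" using K'G fin card_mono by blast
    ultimately have "card (carrier G) - card K' < card (carrier G) - card K" by simp
    from less.hyps[OF this K'(1,4)] K'(2,5) show ?thesis by (metis subsetD)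
  qed
qed

text \<open>The extension starts from the trivial subgroup. There \<open>m\<close> is the order of
  \<open>x\<close>, which is at least 2, so an \<open>m\<close>-th root of unity other than 1 is
  available as the value at \<open>x\<close>.\<close>

lemma ex_separating_character:
  assumes fin: "finite (carrier G)" and x: "x \<in> carrier G" "x \<noteq> \<one>"
  obtains \<chi> where "\<chi> \<in> characters G" "\<chi> x \<noteq> 1"
proof -
  define P where "P m \<longleftrightarrow> m > 0 \<and> x [^] m \<in> {\<one>}" for m :: nat
  obtain n :: nat where "n > 0" "x [^] n = \<one>" using finite_ex_pow_eq_one[OF fin x(1)] .
  then have "P n" by (simp add: P_def)
  then have P: "P (LEAST m. P m)" by (rule LeastI)
  define m where "m = (LEAST m. P m)"
  have m: "m > 0" "x [^] m \<in> {\<one>}" "\<And>j. 0 < j \<Longrightarrow> j < m \<Longrightarrow> x [^] j \<notin> {\<one>}"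
    using P not_less_Least[of _ P] unfolding m_def[symmetric] by (auto simp: P_def)
  have "m \<noteq> 1" using m(2) x by auto
  with m(1) have "m \<ge> 2" by simp
  have "card {z::complex. z ^ m = 1} = m" using m(1) by (rule card_roots_unity_eq)
  then have "\<not> {z::complex. z ^ m = 1} \<subseteq> {1}"
    using \<open>m \<ge> 2\<close> card_mono[of "{1::complex}" "{z. z ^ m = 1}"] by auto
  then obtain z :: complex where z: "z ^ m = 1" "z \<noteq> 1" by blast
  have triv: "character_on G {\<one>} (\<lambda>_. 1)" by (simp add: character_on_def)
  obtain K' \<chi>' where K': "subgroup K' G" "x \<in> K'" "character_on G K' \<chi>'" "\<chi>' x = z"
    using extend_character_on[OF triv_subgroup triv x(1) m z(1)] by metis
  obtain \<chi> where \<chi>: "character_on G (carrier G) \<chi>" "\<forall>y\<in>K'. \<chi> y = \<chi>' y"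
    using extend_character_on_carrier[OF fin K'(1,3)] by blast
  show thesis
  proof
    show "(\<lambda>y. if y \<in> carrier G then \<chi> y else 0) \<in> characters G"
      using \<chi>(1) by (auto simp: characters_def character_on_def)
    show "(if x \<in> carrier G then \<chi> x else 0) \<noteq> 1" using x K' \<chi>(2) z by auto
  qed
qed

section \<open>Values of characters\<close>

lemma characters_mult:
  "\<chi> \<in> characters G \<Longrightarrow> x \<in> carrier G \<Longrightarrow> y \<in> carrier G \<Longrightarrow> \<chi> (x \<otimes> y) = \<chi> x * \<chi> y"
  by (simp add: characters_def)

lemma characters_one [simp]: "\<chi> \<in> characters G \<Longrightarrow> \<chi> \<one> = 1"
  using characters_mult[of \<chi> \<one> \<one>] by (simp add: characters_def)

lemma characters_pow: "\<chi> \<in> characters G \<Longrightarrow> x \<in> carrier G \<Longrightarrow> \<chi> (x [^] (n::nat)) = \<chi> x ^ n"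
  by (induction n) (simp_all add: characters_mult)

text \<open>Values are roots of unity, so conjugation inverts them.\<close>

lemma characters_cnj:
  assumes fin: "finite (carrier G)" and \<chi>: "\<chi> \<in> characters G" and x: "x \<in> carrier G"
  shows "cnj (\<chi> x) = \<chi> (inv x)"
proof -
  obtain n :: nat where n: "n > 0" "x [^] n = \<one>" using finite_ex_pow_eq_one[OF fin x] .
  have "\<chi> x ^ n = 1" using characters_pow[OF \<chi> x, of n] n \<chi> by simp
  then have "norm (\<chi> x) = 1" using n(1) by (metis power_eq_1_iff order_less_irrefl)
  then have "\<chi> x * cnj (\<chi> x) = 1" by (simp add: complex_norm_square[symmetric])
  moreover have "\<chi> x * \<chi> (inv x) = 1" using characters_mult[OF \<chi> x, of "inv x"] x \<chi> by simp
  ultimately have "\<chi> x * cnj (\<chi> x) = \<chi> x * \<chi> (inv x)" by simp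
  moreover have "\<chi> x \<noteq> 0" using \<chi> x by (simp add: characters_def)
  ultimately show ?thesis by simp
qed

text \<open>At each \<open>x\<close> the value is a root of unity of a fixed exponent, so all values
  lie in one finite set \<open>B\<close>.\<close>

lemma finite_characters:
  assumes fin: "finite (carrier G)"
  shows "finite (characters G)"
proof -
  have "\<exists>n::nat. n > 0 \<and> x [^] n = \<one>" if "x \<in> carrier G" for x
    by (rule finite_ex_pow_eq_one[OF fin that]) blast
  then obtain n :: "'a \<Rightarrow> nat" where n: "\<And>x. x \<in> carrier G \<Longrightarrow> n x > 0 \<and> x [^] n x = \<one>"
    by metis
  define B where "B = (\<Union>x\<in>carrier G. {z::complex. z ^ n x = 1})"
  have "finite B" unfolding B_def using fin n by (intro finite_UN_I finite_roots_unity) (auto simp: Suc_le_eq)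
  have "\<chi> x \<in> B" if "\<chi> \<in> characters G" "x \<in> carrier G" for \<chi> x
    using characters_pow[OF that, of "n x"] n[OF that(2)] that by (auto simp: B_def)
  then have "characters G \<subseteq> {f. \<forall>x. (x \<in> carrier G \<longrightarrow> f x \<in> B) \<and> (x \<notin> carrier G \<longrightarrow> f x = 0)}"
    by (auto simp: characters_def)
  then show ?thesis using finite_set_of_finite_funs[OF fin \<open>finite B\<close>] finite_subset by blast
qed

section \<open>Orthogonality relations\<close>

lemma trivial_in_characters [simp]: "trivial_character G \<in> characters G"
  by (simp add: characters_def trivial_character_def)

text \<open>Translation by some \<open>a\<close> with \<open>\<chi> a \<noteq> 1\<close> permutes
  the carrier and multiplies the sum by \<open>\<chi> a\<close>, so the sum is 0.\<close>

lemma sum_character_over_group: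
  assumes "\<chi> \<in> characters G"
  shows "(\<Sum>x\<in>carrier G. \<chi> x) = (if \<chi> = trivial_character G then of_nat (card (carrier G)) else 0)"
proof (cases "\<chi> = trivial_character G")
  case True then show ?thesis by (simp add: trivial_character_def)
next
  case False
  then obtain a where a: "a \<in> carrier G" "\<chi> a \<noteq> 1"
    using assms by (fastforce simp: characters_def trivial_character_def)
  have "(\<Sum>x\<in>carrier G. \<chi> x) = (\<Sum>x\<in>carrier G. \<chi> (a \<otimes> x))"
  proof (rule sum.reindex_bij_witness[of _ "\<lambda>x. a \<otimes> x" "\<lambda>x. inv a \<otimes> x"])
  qed (use a in \<open>auto simp: m_assoc[symmetric]\<close>)
  also have "\<dots> = \<chi> a * (\<Sum>x\<in>carrier G. \<chi> x)"
    using assms a by (simp add: sum_distrib_left characters_mult)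
  finally have "(\<Sum>x\<in>carrier G. \<chi> x) = \<chi> a * (\<Sum>x\<in>carrier G. \<chi> x)" .
  then have "(\<Sum>x\<in>carrier G. \<chi> x) = 0" using a(2) by simp
  then show ?thesis using False by simp
qed

text \<open>The same argument in the character group: multiplication by a character that separates
  \<open>x\<close> from the identity permutes the characters.\<close>

lemma sum_over_characters:
  assumes fin: "finite (carrier G)" and x: "x \<in> carrier G"
  shows "(\<Sum>\<chi>\<in>characters G. \<chi> x) = (if x = \<one> then of_nat (card (characters G)) else 0)"
proof (cases "x = \<one>")
  case True then show ?thesis by simp
next
  case False
  then obtain \<psi> where \<psi>: "\<psi> \<in> characters G" "\<psi> x \<noteq> 1"
    using ex_separating_character fin x by blast
  \<comment> \<open>The inverse of \<open>\<psi>\<close> in the character group, with the default 0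
    that \<open>characters\<close> demands.\<close>
  define \<psi>' where "\<psi>' = (\<lambda>y. if y \<in> carrier G then inverse (\<psi> y) else 0)"
  have "(\<Sum>\<chi>\<in>characters G. \<chi> x) = (\<Sum>\<chi>\<in>characters G. \<psi> x * \<chi> x)"
    by (rule sum.reindex_bij_witness[of _ "\<lambda>\<chi> y. \<psi> y * \<chi> y" "\<lambda>\<chi> y. \<psi>' y * \<chi> y"])
      (use \<psi> x in \<open>auto simp: characters_def \<psi>'_def fun_eq_iff\<close>)
  also have "\<dots> = \<psi> x * (\<Sum>\<chi>\<in>characters G. \<chi> x)" by (simp add: sum_distrib_left)
  finally have "(\<Sum>\<chi>\<in>characters G. \<chi> x) = \<psi> x * (\<Sum>\<chi>\<in>characters G. \<chi> x)" .
  then have "(\<Sum>\<chi>\<in>characters G. \<chi> x) = 0" using \<psi>(2) by simp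
  then show ?thesis using False by simp
qed

text \<open>Each summand is the value of \<open>\<chi>\<close> at
  \<open>x \<otimes> y \<otimes> inv z\<close>. The third factor is there to extract coefficients of
  convolutions; \<open>x = \<one>\<close> gives the usual orthogonality.\<close>

lemma sum_characters_triple:
  assumes fin: "finite (carrier G)" and x: "x \<in> carrier G" and y: "y \<in> carrier G" and z: "z \<in> carrier G"
  shows "(\<Sum>\<chi>\<in>characters G. \<chi> x * \<chi> y * cnj (\<chi> z))
       = (if y = inv x \<otimes> z then of_nat (card (characters G)) else 0)"
proof -
  have "(\<Sum>\<chi>\<in>characters G. \<chi> x * \<chi> y * cnj (\<chi> z)) = (\<Sum>\<chi>\<in>characters G. \<chi> (x \<otimes> y \<otimes> inv z))"
    using assms by (intro sum.cong) (auto simp: characters_cnj characters_mult)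
  also have "\<dots> = (if x \<otimes> y \<otimes> inv z = \<one> then of_nat (card (characters G)) else 0)"
    using assms by (intro sum_over_characters) auto
  also have "x \<otimes> y \<otimes> inv z = \<one> \<longleftrightarrow> y = inv x \<otimes> z"
    using x y z inv_solve_right[of \<one> "x \<otimes> y" z] inv_solve_left[of y x z] by auto
  finally show ?thesis .
qed

end

section \<open>Dual partitions\<close>

text \<open>Weight partitions and dual partitions both have this form, which reduces an equality of
  partitions to two functions identifying the same pairs.\<close>

definition kernel_partition :: "'x set \<Rightarrow> ('x \<Rightarrow> 'k) \<Rightarrow> 'x set set" where
  "kernel_partition X f = X // {(x, y). x \<in> X \<and> y \<in> X \<and> f x = f y}"

lemma kernel_partition_eq_image: "kernel_partition X f = (\<lambda>v. {x\<in>X. f x = v}) ` (f ` X)"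
proof -
  have "{(x, y). x \<in> X \<and> y \<in> X \<and> f x = f y} `` {x} = {y\<in>X. f y = f x}" if "x \<in> X" for x
    using that by auto
  then show ?thesis unfolding kernel_partition_def quotient_def by (simp add: UNION_singleton_eq_range image_image)
qed

lemma same_block_iff:
  "x \<in> X \<Longrightarrow> y \<in> X \<Longrightarrow> (\<exists>B\<in>kernel_partition X f. x \<in> B \<and> y \<in> B) \<longleftrightarrow> f x = f y"
  unfolding kernel_partition_eq_image by auto

lemma kernel_partition_eq_iff:
  "kernel_partition X f = kernel_partition X g \<longleftrightarrow> (\<forall>x\<in>X. \<forall>y\<in>X. f x = f y \<longleftrightarrow> g x = g y)"
proof
  show "kernel_partition X f = kernel_partition X g \<Longrightarrow> \<forall>x\<in>X. \<forall>y\<in>X. f x = f y \<longleftrightarrow> g x = g y"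
    by (simp add: same_block_iff[symmetric])
  show "\<forall>x\<in>X. \<forall>y\<in>X. f x = f y \<longleftrightarrow> g x = g y \<Longrightarrow> kernel_partition X f = kernel_partition X g"
    unfolding kernel_partition_def
    by (rule arg_cong[where f = "\<lambda>r. X // r"]) auto
qed

text \<open>With \<open>u = e y\<close> this is the Fourier transform, at \<open>y\<close>, of the
  indicator of the class with value \<open>v\<close>.\<close>

definition class_sum :: "'x set \<Rightarrow> ('x \<Rightarrow> 'k) \<Rightarrow> ('x \<Rightarrow> complex) \<Rightarrow> 'k \<Rightarrow> complex" where
  "class_sum X f u v = (\<Sum>x | x \<in> X \<and> f x = v. u x)"

lemma restrict_eq_iff: "restrict f A = restrict g A \<longleftrightarrow> (\<forall>x\<in>A. f x = g x)"
  by (auto simp: restrict_def fun_eq_iff)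

text \<open>The dual of a kernel is again a kernel, namely of the map that sends \<open>y\<close> to
  the tuple of the transforms of all classes. \<open>restrict\<close> keeps only the values that
  index actual blocks.\<close>

lemma dual_kernel_partition:
  "dual_partition Y e (kernel_partition X f)
     = kernel_partition Y (\<lambda>y. restrict (class_sum X f (e y)) (f ` X))"
proof -
  have "(\<forall>B\<in>kernel_partition X f. (\<Sum>b\<in>B. e y b) = (\<Sum>b\<in>B. e y' b)) \<longleftrightarrow>
     restrict (class_sum X f (e y)) (f ` X) = restrict (class_sum X f (e y')) (f ` X)" for y y'
    unfolding kernel_partition_eq_image restrict_def class_sum_def fun_eq_iff by auto
  then show ?thesis unfolding dual_partition_def kernel_partition_def by simp
qed

lemma sum_by_class:
  fixes c :: "'k \<Rightarrow> complex"
  assumes "finite X"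
  shows "(\<Sum>x\<in>X. c (f x) * u x) = (\<Sum>v\<in>f ` X. c v * class_sum X f u v)"
proof -
  have "(\<Sum>x\<in>X. c (f x) * u x) = (\<Sum>v\<in>f ` X. \<Sum>x | x \<in> X \<and> f x = v. c (f x) * u x)"
    using assms by (intro sum.group[symmetric]) auto
  also have "\<dots> = (\<Sum>v\<in>f ` X. c v * class_sum X f u v)"
    by (intro sum.cong) (auto simp: class_sum_def sum_distrib_left)
  finally show ?thesis .
qed

section \<open>Bases of function spaces from independent rows\<close>

lemma sum_fun_apply: "(\<Sum>a\<in>A. F a) w = (\<Sum>a\<in>A. F a w)" for F :: "'b \<Rightarrow> 'w \<Rightarrow> complex"
  by (induction A rule: infinite_finite_induct) auto

text \<open>Independent rows that are at least as many as the columns form a basis of the functions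
  on \<open>W\<close>, so each coordinate indicator is a combination of rows.\<close>

lemma independent_rows_generate_indicators:
  fixes M :: "'u \<Rightarrow> 'w \<Rightarrow> complex"
  assumes fin: "finite U" "finite W" and card: "card W \<le> card U"
    and indep: "\<And>c. (\<And>w. w \<in> W \<Longrightarrow> (\<Sum>u\<in>U. c u * M u w) = 0) \<Longrightarrow> \<forall>u\<in>U. c u = 0"
    and w0: "w0 \<in> W"
  shows "\<exists>c. \<forall>w\<in>W. (\<Sum>u\<in>U. c u * M u w) = (if w = w0 then 1 else 0)"
proof -
  interpret fs: vector_space "\<lambda>(c::complex) (f::'w \<Rightarrow> complex) w. c * f w"
    by unfold_locales (auto simp: fun_eq_iff algebra_simps)
  \<comment> \<open>Rows are cut off to 0 outside \<open>W\<close> so that they lie in the span of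
    the coordinate vectors \<open>\<delta> v\<close> with \<open>v \<in> W\<close>.\<close>
  define m where "m u w = (if w \<in> W then M u w else 0)" for u w
  define \<delta> :: "'w \<Rightarrow> 'w \<Rightarrow> complex" where "\<delta> v w = (if w = v then 1 else 0)" for v w
  have inj: "inj_on m U"
  proof (rule inj_onI, rule ccontr)
    fix u v assume uv: "u \<in> U" "v \<in> U" "m u = m v" "u \<noteq> v"
    define c :: "'u \<Rightarrow> complex" where "c x = (if x = u then 1 else 0) - (if x = v then 1 else 0)" for x
    have "(\<Sum>x\<in>U. c x * M x w) = 0" if "w \<in> W" for w
      using that uv(1,2) fin fun_cong[OF uv(3), of w]
      by (simp add: c_def left_diff_distrib sum_subtractf if_distrib[of "\<lambda>x. x * _"] m_def cong: if_cong)
    from indep[OF this] uv show False by (auto simp: c_def)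
  qed
  have "fs.independent (m ` U)"
  proof (rule fs.independent_if_scalars_zero)
    show "finite (m ` U)" using fin by simp
    fix f x assume zero: "(\<Sum>x\<in>m ` U. (\<lambda>w. f x * x w)) = 0" and x: "x \<in> m ` U"
    have "(\<Sum>u\<in>U. f (m u) * M u w) = 0" if "w \<in> W" for w
    proof -
      have "(\<Sum>u\<in>U. f (m u) * M u w) = (\<Sum>u\<in>U. f (m u) * m u w)" using that by (simp add: m_def)
      also have "\<dots> = (\<Sum>x\<in>m ` U. f x * x w)" by (simp add: sum.reindex[OF inj])
      also have "\<dots> = (\<Sum>x\<in>m ` U. (\<lambda>w. f x * x w)) w" by (simp add: sum_fun_apply)
      finally show ?thesis by (simp add: zero)
    qed
    from indep[OF this] x show "f x = 0" by auto
  qed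
  moreover have span: "m ` U \<subseteq> fs.span (\<delta> ` W)"
  proof safe
    fix u assume "u \<in> U"
    have "m u = (\<Sum>v\<in>W. (\<lambda>w. m u v * \<delta> v w))"
      using fin by (simp add: fun_eq_iff sum_fun_apply \<delta>_def if_distrib[of "\<lambda>x. _ * x"] m_def cong: if_cong)
    also have "\<dots> \<in> fs.span (\<delta> ` W)"
      by (intro fs.span_sum fs.span_scale fs.span_base) auto
    finally show "m u \<in> fs.span (\<delta> ` W)" .
  qed
  moreover have "card (\<delta> ` W) \<le> card (m ` U)"
    using card card_image[OF inj] card_image_le[OF fin(2), of \<delta>] by simp
  moreover have "\<delta> w0 \<in> fs.span (\<delta> ` W)" using w0 by (intro fs.span_base) auto
  ultimately have "\<delta> w0 \<in> fs.span (m ` U)"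
  proof -
    assume ind: "fs.independent (m ` U)" and le: "card (\<delta> ` W) \<le> card (m ` U)"
    show ?thesis
    proof (rule ccontr)
      assume out: "\<delta> w0 \<notin> fs.span (m ` U)"
      then have "fs.independent (insert (\<delta> w0) (m ` U))" using ind by (intro fs.independent_insertI)
      then have "card (insert (\<delta> w0) (m ` U)) \<le> card (\<delta> ` W)"
        using fs.independent_span_bound[of "\<delta> ` W"] span w0 fin fs.span_base[of "\<delta> w0" "\<delta> ` W"] by auto
      moreover have "\<delta> w0 \<notin> m ` U" using out fs.span_base by blast
      ultimately show False using le fin by simp
    qed
  qed
  then obtain f where f: "\<delta> w0 = (\<Sum>v\<in>m ` U. (\<lambda>w. f v * v w))"
    using fin by (auto simp: fs.span_finite)
  show ?thesis
  proof (intro exI[of _ "\<lambda>u. f (m u)"] ballI)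
    fix w assume "w \<in> W"
    then have "(\<Sum>u\<in>U. f (m u) * M u w) = (\<Sum>x\<in>m ` U. f x * x w)"
      by (simp add: sum.reindex[OF inj] m_def)
    also have "\<dots> = \<delta> w0 w" unfolding f by (simp add: sum_fun_apply)
    finally show "(\<Sum>u\<in>U. f (m u) * M u w) = (if w = w0 then 1 else 0)" by (simp add: \<delta>_def)
  qed
qed

section \<open>Fourier inversion for an abstract pairing\<close>

locale fourier_pairing =
  fixes X :: "'x set" and Y :: "'y set" and e :: "'y \<Rightarrow> 'x \<Rightarrow> complex" and N :: complex
  assumes finX: "finite X" and finY: "finite Y" and N: "N \<noteq> 0"
    and orth: "\<And>b d. b \<in> X \<Longrightarrow> d \<in> X \<Longrightarrow> (\<Sum>y\<in>Y. e y b * cnj (e y d)) = (if b = d then N else 0)"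
begin

text \<open>The inner sum is the transform of the function \<open>c o f\<close>; orthogonality
  recovers the function up to the factor \<open>N\<close>.\<close>

lemma inversion:
  fixes f :: "'x \<Rightarrow> 'k" and c :: "'k \<Rightarrow> complex"
  assumes b: "b \<in> X"
  shows "(\<Sum>y\<in>Y. (\<Sum>v\<in>f ` X. c v * class_sum X f (e y) v) * cnj (e y b)) = N * c (f b)"
proof -
  have "(\<Sum>y\<in>Y. (\<Sum>v\<in>f ` X. c v * class_sum X f (e y) v) * cnj (e y b))
      = (\<Sum>y\<in>Y. \<Sum>x\<in>X. c (f x) * (e y x * cnj (e y b)))"
    by (simp add: sum_by_class[OF finX, symmetric] sum_distrib_right mult.assoc)
  also have "\<dots> = (\<Sum>x\<in>X. c (f x) * (\<Sum>y\<in>Y. e y x * cnj (e y b)))"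
    by (subst sum.swap) (simp add: sum_distrib_left)
  also have "\<dots> = (\<Sum>x\<in>X. if x = b then c (f x) * N else 0)"
    using b by (intro sum.cong) (auto simp: orth)
  also have "\<dots> = N * c (f b)" using b finX by simp
  finally show ?thesis .
qed

text \<open>Points that are equivalent in the dual of the \<open>g\<close>-partition have equal
  inverse transforms of every function of \<open>g\<close>. Conjugation connects the class sums of
  the dual partition with the kernel of the inverse transform.\<close>

lemma class_sum_cnj_cong:
  assumes "\<And>v. v \<in> g ` Y \<Longrightarrow> class_sum Y g (\<lambda>y. e y b) v = class_sum Y g (\<lambda>y. e y d) v"
  shows "(\<Sum>y\<in>Y. c (g y) * cnj (e y b)) = (\<Sum>y\<in>Y. c (g y) * cnj (e y d))"
proof -
  have "class_sum Y g (\<lambda>y. cnj (e y x)) v = cnj (class_sum Y g (\<lambda>y. e y x) v)" for x v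
    by (simp add: class_sum_def)
  then show ?thesis using assms
    by (simp add: sum_by_class[OF finY, of c g])
qed

text \<open>By inversion the transforms of the f-classes are independent, so the inequality between
  the cardinalities forces the indicators of the g-classes to be transforms.\<close>

lemma dual_and_bidual:
  assumes const: "\<And>y y' v. y \<in> Y \<Longrightarrow> y' \<in> Y \<Longrightarrow> g y = g y' \<Longrightarrow> v \<in> f ` X
                   \<Longrightarrow> class_sum X f (e y) v = class_sum X f (e y') v"
    and card: "card (g ` Y) \<le> card (f ` X)"
  shows "dual_partition Y e (kernel_partition X f) = kernel_partition Y g"
    and "dual_partition X (\<lambda>x y. e y x) (kernel_partition Y g) = kernel_partition X f"
proof -
  \<comment> \<open>\<open>M v w\<close> is the value of the transform of the class \<open>v\<close>
    on the dual class \<open>w\<close>; by \<open>const\<close> the representative does not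
    matter.\<close>
  define M where "M v w = class_sum X f (e (SOME y. y \<in> Y \<and> g y = w)) v" for v w
  have M: "M v (g y) = class_sum X f (e y) v" if "y \<in> Y" "v \<in> f ` X" for v y
  proof -
    have "(SOME y'. y' \<in> Y \<and> g y' = g y) \<in> Y \<and> g (SOME y'. y' \<in> Y \<and> g y' = g y) = g y"
      by (rule someI[of "\<lambda>y'. y' \<in> Y \<and> g y' = g y" y]) (use that in simp)
    with that show ?thesis unfolding M_def by (intro const) simp_all
  qed
  have indep: "\<forall>v\<in>f ` X. c v = 0" if "\<And>w. w \<in> g ` Y \<Longrightarrow> (\<Sum>v\<in>f ` X. c v * M v w) = 0" for c
  proof
    fix v assume "v \<in> f ` X"
    then obtain b where b: "b \<in> X" "v = f b" by auto
    have "N * c (f b) = (\<Sum>y\<in>Y. (\<Sum>v\<in>f ` X. c v * M v (g y)) * cnj (e y b))"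
      using inversion[OF b(1), where f = f and c = c] M by simp
    also have "\<dots> = 0" using that by simp
    finally show "c v = 0" using N b by simp
  qed
  have ind: "\<exists>c. \<forall>w\<in>g ` Y. (\<Sum>v\<in>f ` X. c v * M v w) = (if w = w0 then 1 else 0)" if "w0 \<in> g ` Y" for w0
    by (rule independent_rows_generate_indicators[OF finite_imageI[OF finX] finite_imageI[OF finY] card indep that])
  \<comment> \<open>The indicator of the \<open>g\<close>-class of \<open>y\<close> is a combination
    of class transforms, so equal transforms give equal indicators.\<close>
  have sep: "g y = g y'" if y: "y \<in> Y" "y' \<in> Y"
    and eq: "\<And>v. v \<in> f ` X \<Longrightarrow> class_sum X f (e y) v = class_sum X f (e y') v" for y y'
  proof -
    obtain c where c: "\<forall>w\<in>g ` Y. (\<Sum>v\<in>f ` X. c v * M v w) = (if w = g y then 1 else 0)"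
      using ind y by blast
    have "(\<Sum>v\<in>f ` X. c v * M v (g y)) = (\<Sum>v\<in>f ` X. c v * M v (g y'))"
      using eq M y by (intro sum.cong) auto
    moreover have "(\<Sum>v\<in>f ` X. c v * M v (g y)) = 1" using c y by auto
    moreover have "(\<Sum>v\<in>f ` X. c v * M v (g y')) = (if g y' = g y then 1 else 0)" using c y by auto
    ultimately show ?thesis by (auto split: if_splits)
  qed
  show "dual_partition Y e (kernel_partition X f) = kernel_partition Y g"
    unfolding dual_kernel_partition kernel_partition_eq_iff restrict_eq_iff
    by (intro ballI iffI) (rule sep, assumption, assumption, erule bspec, assumption, rule const)
  \<comment> \<open>The indicator of the class \<open>w\<close> is the transform of a function
    \<open>c\<close> of \<open>f\<close>, so its inverse transform at \<open>x\<close> depends only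
    on \<open>f x\<close>.\<close>
  have bi1: "class_sum Y g (\<lambda>y. e y b) w = class_sum Y g (\<lambda>y. e y d) w"
    if bd: "b \<in> X" "d \<in> X" "f b = f d" and w: "w \<in> g ` Y" for b d w
  proof -
    obtain c where c: "\<forall>w'\<in>g ` Y. (\<Sum>v\<in>f ` X. c v * M v w') = (if w' = w then 1 else 0)"
      using ind w by blast
    have "cnj (class_sum Y g (\<lambda>y. e y x) w) = N * c (f x)" if x: "x \<in> X" for x
    proof -
      have "cnj (class_sum Y g (\<lambda>y. e y x) w) = (\<Sum>y\<in>Y. if g y = w then cnj (e y x) else 0)"
        using finY by (simp add: class_sum_def sum.inter_filter[symmetric])
      also have "\<dots> = (\<Sum>y\<in>Y. (\<Sum>v\<in>f ` X. c v * M v (g y)) * cnj (e y x))"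
        using c by (intro sum.cong) auto
      also have "\<dots> = N * c (f x)" using inversion[OF x, where f = f and c = c] M by simp
      finally show ?thesis .
    qed
    from this[OF bd(1)] this[OF bd(2)] bd(3)
    have "cnj (class_sum Y g (\<lambda>y. e y b) w) = cnj (class_sum Y g (\<lambda>y. e y d) w)" by simp
    then show ?thesis by simp
  qed
  \<comment> \<open>Conversely, the indicator of the \<open>f\<close>-class of \<open>b\<close> has
    a transform that is a function of \<open>g\<close>, and inversion recovers it from sums that
    agree at \<open>b\<close> and \<open>d\<close>.\<close>
  have bi2: "f b = f d" if bd: "b \<in> X" "d \<in> X"
    and eq: "\<And>w. w \<in> g ` Y \<Longrightarrow> class_sum Y g (\<lambda>y. e y b) w = class_sum Y g (\<lambda>y. e y d) w" for b d
  proof -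
    define c :: "_ \<Rightarrow> complex" where "c v = (if v = f b then 1 else 0)" for v
    have "N * c (f x) = (\<Sum>y\<in>Y. (\<Sum>v\<in>f ` X. c v * M v (g y)) * cnj (e y x))" if "x \<in> X" for x
      using inversion[OF that, where f = f and c = c] M by simp
    then have "N * c (f b) = N * c (f d)"
      using bd class_sum_cnj_cong[of g b d "\<lambda>w. \<Sum>v\<in>f ` X. c v * M v w"] eq by simp
    then show ?thesis using N by (simp add: c_def split: if_splits)
  qed
  show "dual_partition X (\<lambda>x y. e y x) (kernel_partition Y g) = kernel_partition X f"
    unfolding dual_kernel_partition kernel_partition_eq_iff restrict_eq_iff
    by (intro ballI iffI) (rule bi2, assumption, assumption, erule bspec, assumption, rule bi1)
qed

end

section \<open>Ideals and levels of a finite poset\<close>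

locale finite_poset =
  fixes \<Omega> :: "'i set" and r :: "('i \<times> 'i) set"
  assumes finite_ground: "finite \<Omega>" and partial_order: "partial_order_on \<Omega> r"
begin

lemma le_refl: "u \<in> \<Omega> \<Longrightarrow> (u, u) \<in> r"
  using partial_order_onD(1)[OF partial_order] by (simp add: refl_on_def)

lemma le_trans: "(u, v) \<in> r \<Longrightarrow> (v, w) \<in> r \<Longrightarrow> (u, w) \<in> r"
  using partial_order_onD(2)[OF partial_order] by (rule transD)

lemma le_antisym: "(u, v) \<in> r \<Longrightarrow> (v, u) \<in> r \<Longrightarrow> u = v"
  using partial_order_onD(3)[OF partial_order] by (rule antisymD)

lemma le_ground: "(u, v) \<in> r \<Longrightarrow> u \<in> \<Omega> \<and> v \<in> \<Omega>"
  using partial_order_onD(4)[OF partial_order] by blast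

lemma ideal_ground: "ideal \<Omega> r B \<subseteq> \<Omega>"
  by (auto simp: ideal_def)

lemma finite_ideal: "finite (ideal \<Omega> r B)"
  using ideal_ground finite_ground finite_subset by blast

lemma subset_ideal: "B \<subseteq> \<Omega> \<Longrightarrow> B \<subseteq> ideal \<Omega> r B"
  using le_refl by (auto simp: ideal_def)

lemma ideal_mono: "B \<subseteq> C \<Longrightarrow> ideal \<Omega> r B \<subseteq> ideal \<Omega> r C"
  by (auto simp: ideal_def)

lemma ideal_idem: "ideal \<Omega> r (ideal \<Omega> r B) = ideal \<Omega> r B"
  using le_trans le_refl by (auto simp: ideal_def)

lemma ideal_eq_self_iff:
  "ideal \<Omega> r B = B \<longleftrightarrow> B \<subseteq> \<Omega> \<and> (\<forall>b\<in>B. \<forall>a. (a, b) \<in> r \<longrightarrow> a \<in> B)"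
  using le_refl le_ground by (auto simp: ideal_def) blast+

lemma down_closedD: "ideal \<Omega> r B = B \<Longrightarrow> b \<in> B \<Longrightarrow> (a, b) \<in> r \<Longrightarrow> a \<in> B"
  unfolding ideal_eq_self_iff by blast

section \<open>Lengths of chains\<close>

definition chains_below :: "'i \<Rightarrow> 'i set set" where
  "chains_below y = {C. C \<subseteq> \<Omega> \<and> y \<in> C \<and> (\<forall>c\<in>C. (c, y) \<in> r)
                              \<and> (\<forall>a\<in>C. \<forall>b\<in>C. (a, b) \<in> r \<or> (b, a) \<in> r)}"

lemma chain_len_eq: "chain_len \<Omega> r y = Max (card ` chains_below y)"
  unfolding chain_len_def chains_below_def by (rule arg_cong[where f = Max]) auto

lemma finite_chains_below: "finite (chains_below y)"
  by (rule finite_subset[of _ "Pow \<Omega>"]) (use finite_ground in \<open>auto simp: chains_below_def\<close>)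

lemma chain_len_ge: "C \<in> chains_below y \<Longrightarrow> card C \<le> chain_len \<Omega> r y"
  unfolding chain_len_eq using finite_chains_below by simp

lemma longest_chain:
  assumes "y \<in> \<Omega>"
  obtains C where "C \<in> chains_below y" "card C = chain_len \<Omega> r y"
proof -
  have "{y} \<in> chains_below y" using assms le_refl by (auto simp: chains_below_def)
  then have "Max (card ` chains_below y) \<in> card ` chains_below y"
    using finite_chains_below by (intro Max_in) auto
  then show thesis using that by (auto simp: chain_len_eq)
qed

lemma chain_len_pos: "y \<in> \<Omega> \<Longrightarrow> chain_len \<Omega> r y \<ge> 1"
  using chain_len_ge[of "{y}" y] le_refl by (auto simp: chains_below_def)

text \<open>A longest chain with greatest element \<open>u\<close> can be extended by
  \<open>v\<close>.\<close>

lemma chain_len_strict_mono: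
  assumes uv: "(u, v) \<in> r" "u \<noteq> v"
  shows "chain_len \<Omega> r u < chain_len \<Omega> r v"
proof -
  obtain C where C: "C \<in> chains_below u" "card C = chain_len \<Omega> r u"
    using longest_chain uv le_ground by blast
  have "v \<notin> C" using C(1) uv le_antisym by (auto simp: chains_below_def)
  moreover have "(c, v) \<in> r" if "c \<in> C" for c
    using C(1) that le_trans[OF _ uv(1)] by (simp add: chains_below_def)
  then have "insert v C \<in> chains_below v"
    using C(1) le_ground[OF uv(1)] le_refl[of v] by (simp add: chains_below_def)
  moreover have "finite C" using C(1) finite_ground finite_subset by (auto simp: chains_below_def)
  ultimately show ?thesis using chain_len_ge[of "insert v C" v] C(2) by simp
qed

lemma chain_len_le_Suc:
  assumes y: "y \<in> \<Omega>" and below: "\<And>u. (u, y) \<in> r \<Longrightarrow> u \<noteq> y \<Longrightarrow> chain_len \<Omega> r u \<le> l"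
  shows "chain_len \<Omega> r y \<le> Suc l"
proof -
  obtain C where C: "C \<in> chains_below y" "card C = chain_len \<Omega> r y"
    using longest_chain y by blast
  have finC: "finite C" using C(1) finite_ground finite_subset by (auto simp: chains_below_def)
  have yC: "y \<in> C" using C(1) by (simp add: chains_below_def)
  have "card (C - {y}) \<le> l"
  proof (cases "C - {y} = {}")
    case True then show ?thesis by (metis card.empty le0)
  next
    case False
    \<comment> \<open>In a chain the element of greatest length is the greatest element, so the rest
      of the chain ends in \<open>u\<close>.\<close>
    obtain u where u: "u \<in> C - {y}" and max: "\<And>c. c \<in> C - {y} \<Longrightarrow> chain_len \<Omega> r c \<le> chain_len \<Omega> r u"
    proof -
      have "Max (chain_len \<Omega> r ` (C - {y})) \<in> chain_len \<Omega> r ` (C - {y})"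
        using finC False by (intro Max_in) auto
      then obtain u where "u \<in> C - {y}" "Max (chain_len \<Omega> r ` (C - {y})) = chain_len \<Omega> r u" by blast
      then show thesis using that[of u] Max_ge[of "chain_len \<Omega> r ` (C - {y})"] finC by simp
    qed
    have "(c, u) \<in> r" if c: "c \<in> C - {y}" for c
    proof (rule ccontr)
      assume "(c, u) \<notin> r"
      then have "(u, c) \<in> r" "u \<noteq> c" using C(1) u c le_refl by (auto simp: chains_below_def)
      then show False using chain_len_strict_mono max[OF c] by force
    qed
    then have "C - {y} \<in> chains_below u" using C(1) u by (auto simp: chains_below_def)
    then have "card (C - {y}) \<le> chain_len \<Omega> r u" by (rule chain_len_ge)
    also have "\<dots> \<le> l" using below u C(1) by (auto simp: chains_below_def)
    finally show ?thesis .
  qed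
  then show ?thesis using C(2) finC yC by (simp add: card_Diff_singleton)
qed

text \<open>Ideals can be built one element at a time: an element of least length outside an ideal
  has everything strictly below it inside.\<close>

lemma ex_ideal_of_card:
  assumes "k \<le> card \<Omega>"
  shows "\<exists>I. ideal \<Omega> r I = I \<and> card I = k"
  using assms
proof (induction k)
  case 0
  show ?case by (rule exI[of _ "{}"]) (auto simp: ideal_def)
next
  case (Suc k)
  then obtain I where I: "ideal \<Omega> r I = I" "card I = k" by auto
  have IG: "I \<subseteq> \<Omega>" using I(1) ideal_ground by blast
  then have "\<Omega> - I \<noteq> {}" using Suc.prems I(2) finite_ground by auto
  then obtain v where v: "v \<in> \<Omega> - I" and min: "\<And>u. u \<in> \<Omega> - I \<Longrightarrow> chain_len \<Omega> r v \<le> chain_len \<Omega> r u"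
    using ex_is_arg_min_if_finite[of "\<Omega> - I" "chain_len \<Omega> r"] finite_ground
    by (auto simp: is_arg_min_def not_less)
  have "a \<in> insert v I" if b: "b \<in> insert v I" and ab: "(a, b) \<in> r" for a b
  proof (cases "b = v")
    case True
    then show ?thesis using min[of a] chain_len_strict_mono[of a v] le_ground ab by force
  next
    case False then show ?thesis using b ab down_closedD[OF I(1)] by blast
  qed
  then have "ideal \<Omega> r (insert v I) = insert v I"
    unfolding ideal_eq_self_iff using IG v by blast
  moreover have "card (insert v I) = Suc k" using v I(2) IG finite_ground finite_subset by fastforce
  ultimately show ?case by blast
qed

text \<open>Every weight occurs. Applied to the poset and to its dual, this gives both weight
  partitions the same number of blocks.\<close>

lemma range_ideal_card:
  assumes sub: "\<And>x. x \<in> X \<Longrightarrow> supp x \<subseteq> \<Omega>" and surj: "\<And>A. A \<subseteq> \<Omega> \<Longrightarrow> \<exists>x\<in>X. supp x = A"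
  shows "(\<lambda>x. card (ideal \<Omega> r (supp x))) ` X = {..card \<Omega>}"
proof (intro equalityI subsetI)
  fix k assume "k \<in> (\<lambda>x. card (ideal \<Omega> r (supp x))) ` X"
  then show "k \<in> {..card \<Omega>}" using card_mono[OF finite_ground ideal_ground] by auto
next
  fix k assume "k \<in> {..card \<Omega>}"
  then obtain I where I: "ideal \<Omega> r I = I" "card I = k" using ex_ideal_of_card by auto
  then obtain x where "x \<in> X" "supp x = I" using surj ideal_ground by metis
  with I show "k \<in> (\<lambda>x. card (ideal \<Omega> r (supp x))) ` X"
    by (intro image_eqI[of _ _ x]) simp_all
qed

section \<open>Levels and domination\<close>

definition lower :: "nat \<Rightarrow> 'i set" where
  "lower l = {u\<in>\<Omega>. chain_len \<Omega> r u \<le> l}"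

definition level :: "nat \<Rightarrow> 'i set" where
  "level l = {u\<in>\<Omega>. chain_len \<Omega> r u = l}"

lemma finite_lower: "finite (lower l)" and finite_level: "finite (level l)"
  using finite_ground by (auto simp: lower_def level_def)

lemma lower_closed: "b \<in> lower l \<Longrightarrow> (a, b) \<in> r \<Longrightarrow> a \<in> lower l"
  using chain_len_strict_mono[of a b] le_ground[of a b] by (cases "a = b") (auto simp: lower_def)

lemma below_level: "i \<in> level (Suc l) \<Longrightarrow> (a, i) \<in> r \<Longrightarrow> a = i \<or> a \<in> lower l"
  using chain_len_strict_mono[of a i] le_ground[of a i] by (cases "a = i") (auto simp: lower_def level_def)

lemma ideal_lower_Un:
  assumes "S \<subseteq> level (Suc l)"
  shows "ideal \<Omega> r (lower l \<union> S) = lower l \<union> S"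
  unfolding ideal_eq_self_iff
proof (intro conjI ballI allI impI)
  show "lower l \<union> S \<subseteq> \<Omega>" using assms by (auto simp: lower_def level_def)
  fix a b assume "b \<in> lower l \<union> S" "(a, b) \<in> r"
  then show "a \<in> lower l \<union> S" using assms lower_closed below_level by blast
qed

text \<open>\<open>hierarchical\<close> amounts to this condition for all \<open>l\<close>; stated
  for a single \<open>l\<close> it can serve as an induction hypothesis.\<close>

definition dominated :: "nat \<Rightarrow> bool" where
  "dominated l \<longleftrightarrow> (\<forall>u\<in>lower l. \<forall>v\<in>\<Omega> - lower l. (u, v) \<in> r)"

lemma level_disjoint_lower: "i \<in> level (Suc l) \<Longrightarrow> i \<notin> lower l"
  by (simp add: level_def lower_def)

text \<open>Up to a constant factor, the sum over the complement of K counts the words of weight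
  |lower l| + 1 that move a word generating the ideal K to a word of weight |K| + 1.\<close>

lemma hierarchical_if_level_sums_invariant:
  fixes h :: "'i \<Rightarrow> nat"
  assumes h: "\<And>i. i \<in> \<Omega> \<Longrightarrow> h i \<ge> 2"
    and inv: "\<And>l K K'. dominated l \<Longrightarrow> ideal \<Omega> r K = K \<Longrightarrow> ideal \<Omega> r K' = K' \<Longrightarrow>
       \<not> K \<subseteq> lower l \<Longrightarrow> \<not> K' \<subseteq> lower l \<Longrightarrow> card K = card K' \<Longrightarrow>
       (\<Sum>i\<in>level (Suc l) - K. h i - 1) = (\<Sum>i\<in>level (Suc l) - K'. h i - 1)"
  shows "hierarchical \<Omega> r"
    and "\<And>u v. u \<in> \<Omega> \<Longrightarrow> v \<in> \<Omega> \<Longrightarrow> chain_len \<Omega> r u = chain_len \<Omega> r v \<Longrightarrow> h u = h v"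
proof -
  have dom: "dominated l" for l
  proof (induction l)
    case 0
    \<comment> \<open>Lengths start at 1, so \<open>lower 0\<close> is empty.\<close>
    show ?case using chain_len_pos by (force simp: dominated_def lower_def)
  next
    case (Suc l)
    let ?M = "level (Suc l)"
    have split: "lower (Suc l) = lower l \<union> ?M" by (auto simp: lower_def level_def)
    \<comment> \<open>A second induction, on the length of \<open>v\<close>, shows that everything
      beyond the level \<open>?M\<close> lies above all of it.\<close>
    have above: "\<forall>i\<in>?M. (i, v) \<in> r" if "v \<in> \<Omega> - lower (Suc l)" for v
      using that
    proof (induction "chain_len \<Omega> r v" arbitrary: v rule: less_induct)
      case less
      show ?case
      proof (rule ccontr)
        assume "\<not> (\<forall>i\<in>?M. (i, v) \<in> r)"
        then obtain i where i: "i \<in> ?M" "(i, v) \<notin> r" by blast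
        \<comment> \<open>\<open>?K'\<close> is \<open>?K\<close> with \<open>v\<close> replaced by
          the element \<open>i\<close> that is not below \<open>v\<close>. The sizes agree, while
          the complements within \<open>?M\<close> differ exactly by \<open>i\<close>.\<close>
        let ?K = "ideal \<Omega> r {v}" and ?K' = "lower l \<union> insert i (ideal \<Omega> r {v} \<inter> ?M)"
        have v: "v \<in> \<Omega>" "v \<notin> lower l" "v \<notin> ?M" using less.prems split by auto
        \<comment> \<open>Beyond the level \<open>?M\<close>, the inner induction puts
          \<open>i\<close> below \<open>u\<close>, hence below \<open>v\<close>.\<close>
        have below: "u \<in> lower l \<union> ?M" if u: "(u, v) \<in> r" "u \<noteq> v" for u
        proof (rule ccontr)
          assume "u \<notin> lower l \<union> ?M"
          then have "(i, u) \<in> r"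
            using less.hyps[of u] chain_len_strict_mono[OF u] le_ground u i split by blast
          then show False using i u le_trans by blast
        qed
        have mem: "a \<in> ?K \<longleftrightarrow> (a, v) \<in> r" for a using le_ground by (auto simp: ideal_def)
        have "u \<in> ?K" if "u \<in> lower l" for u
          using that Suc v(1,2) unfolding mem dominated_def by blast
        moreover have "v \<in> ?K" using le_refl v(1) unfolding mem by blast
        ultimately have K: "?K = insert v (lower l \<union> (?K \<inter> ?M))"
          using below unfolding mem[symmetric] by blast
        have disj: "lower l \<inter> (?K \<inter> ?M) = {}" "i \<notin> lower l" "i \<notin> ?K"
          using level_disjoint_lower i unfolding mem by blast+
        have "card ?K = Suc (card (lower l \<union> (?K \<inter> ?M)))"
          by (subst K) (use v finite_lower finite_level in auto)
        also have "\<dots> = card (insert i (lower l \<union> (?K \<inter> ?M)))"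
          using disj finite_lower finite_level by auto
        finally have card: "card ?K = card ?K'" by simp
        have "(\<Sum>i\<in>?M - ?K. h i - 1) = (\<Sum>i\<in>?M - ?K'. h i - 1)"
        proof (rule inv[OF Suc ideal_idem _ _ _ card])
          show "ideal \<Omega> r ?K' = ?K'" using i by (intro ideal_lower_Un) auto
          show "\<not> ?K \<subseteq> lower l" using v le_refl by (auto simp: ideal_def)
          show "\<not> ?K' \<subseteq> lower l" using disj by auto
        qed
        also have "?M - ?K' = ?M - ?K - {i}" using level_disjoint_lower by auto
        also have "(\<Sum>i\<in>?M - ?K. h i - 1) = (h i - 1) + (\<Sum>i\<in>?M - ?K - {i}. h i - 1)"
          using finite_level i disj by (intro sum.remove) auto
        \<comment> \<open>The two level sums differ by this term, which \<open>h i \<ge> 2\<close>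
          makes positive.\<close>
        finally have "h i - 1 = 0" by simp
        then show False using h[of i] i by (simp add: level_def)
      qed
    qed
    have "(u, v) \<in> r" if "u \<in> lower (Suc l)" "v \<in> \<Omega> - lower (Suc l)" for u v
      using that above[of v] Suc unfolding split dominated_def by blast
    then show ?case unfolding dominated_def by blast
  qed
  show "hierarchical \<Omega> r"
    unfolding hierarchical_def
  proof (intro ballI impI)
    fix u v assume "u \<in> \<Omega>" "v \<in> \<Omega>" "chain_len \<Omega> r u + 1 \<le> chain_len \<Omega> r v"
    then show "(u, v) \<in> r" using dom[of "chain_len \<Omega> r u"] by (auto simp: dominated_def lower_def)
  qed
  fix u v assume uv: "u \<in> \<Omega>" "v \<in> \<Omega>" "chain_len \<Omega> r u = chain_len \<Omega> r v"
  obtain l where l: "chain_len \<Omega> r u = Suc l" using chain_len_pos[OF uv(1)] by (cases "chain_len \<Omega> r u") auto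
  let ?M = "level (Suc l)"
  have M: "u \<in> ?M" "v \<in> ?M" using uv l by (auto simp: level_def)
  \<comment> \<open>Two ideals of equal size whose level sums omit only \<open>u\<close> and only
    \<open>v\<close>.\<close>
  have "(\<Sum>i\<in>?M - (lower l \<union> {u}). h i - 1) = (\<Sum>i\<in>?M - (lower l \<union> {v}). h i - 1)"
  proof (rule inv[OF dom])
    show "ideal \<Omega> r (lower l \<union> {u}) = lower l \<union> {u}" "ideal \<Omega> r (lower l \<union> {v}) = lower l \<union> {v}"
      using ideal_lower_Un[of "{u}" l] ideal_lower_Un[of "{v}" l] M by blast+
  qed (use M level_disjoint_lower finite_lower in auto)
  moreover have "?M - (lower l \<union> {w}) = ?M - {w}" for w using level_disjoint_lower by auto
  ultimately have "(\<Sum>i\<in>?M - {u}. h i - 1) = (\<Sum>i\<in>?M - {v}. h i - 1)" by simp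
  moreover have "(\<Sum>i\<in>?M. h i - 1) = (h w - 1) + (\<Sum>i\<in>?M - {w}. h i - 1)" if "w \<in> ?M" for w
    using that finite_level by (intro sum.remove)
  from this[OF M(1)] this[OF M(2)] calculation have "h u - 1 = h v - 1" by simp
  then show "h u = h v" using h[OF uv(1)] h[OF uv(2)] by simp
qed

section \<open>Ideals over a dominated lower set\<close>

lemma lower_subset_ideal:
  assumes dom: "dominated l" and v: "v \<in> \<Omega>" "v \<notin> lower l" "v \<in> S"
  shows "insert v (lower l) \<subseteq> ideal \<Omega> r S"
proof
  fix u assume "u \<in> insert v (lower l)"
  then have "(u, v) \<in> r" using dom v le_refl[of v] unfolding dominated_def by blast
  then show "u \<in> ideal \<Omega> r S" using le_ground v(3) unfolding ideal_def by blast
qed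

lemma ideal_subset_lower: "S \<subseteq> lower l \<Longrightarrow> ideal \<Omega> r S \<subseteq> lower l"
  unfolding ideal_def using lower_closed by blast

text \<open>By domination, a set not contained in \<open>lower l\<close> generates all of
  \<open>lower l\<close>. The size leaves room for one further element, and this has only elements
  of \<open>lower l\<close> strictly below it, so its length is \<open>Suc l\<close>.\<close>

lemma card_ideal_eq_Suc_lower_iff:
  assumes dom: "dominated l" and S: "S \<subseteq> \<Omega>"
  shows "card (ideal \<Omega> r S) = Suc (card (lower l))
     \<longleftrightarrow> (\<exists>i\<in>level (Suc l). i \<in> S \<and> S \<subseteq> insert i (lower l))"
proof
  assume card: "card (ideal \<Omega> r S) = Suc (card (lower l))"
  have "\<not> S \<subseteq> lower l"
  proof
    assume "S \<subseteq> lower l"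
    then have "card (ideal \<Omega> r S) \<le> card (lower l)"
      using card_mono[OF finite_lower ideal_subset_lower] by blast
    then show False using card by linarith
  qed
  then obtain v where v: "v \<in> S" "v \<notin> lower l" by blast
  have sub: "insert v (lower l) \<subseteq> ideal \<Omega> r S"
    using lower_subset_ideal[OF dom] v S by blast
  then have eq: "insert v (lower l) = ideal \<Omega> r S"
    using card v finite_lower by (intro card_subset_eq finite_ideal) auto
  have "chain_len \<Omega> r u \<le> l" if "(u, v) \<in> r" "u \<noteq> v" for u
  proof -
    have "u \<in> ideal \<Omega> r S" using that v le_ground by (auto simp: ideal_def)
    then show ?thesis using that unfolding eq[symmetric] by (auto simp: lower_def)
  qed
  then have "chain_len \<Omega> r v \<le> Suc l" using v S by (intro chain_len_le_Suc) auto
  then have "v \<in> level (Suc l)" using v S by (auto simp: level_def lower_def)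
  then show "\<exists>i\<in>level (Suc l). i \<in> S \<and> S \<subseteq> insert i (lower l)"
    using v subset_ideal[OF S] eq by auto
next
  assume "\<exists>i\<in>level (Suc l). i \<in> S \<and> S \<subseteq> insert i (lower l)"
  then obtain i where i: "i \<in> level (Suc l)" "i \<in> S" "S \<subseteq> insert i (lower l)" by blast
  have "ideal \<Omega> r S = insert i (lower l)"
  proof
    have "ideal \<Omega> r S \<subseteq> ideal \<Omega> r (lower l \<union> {i})" using i(3) by (intro ideal_mono) auto
    then show "ideal \<Omega> r S \<subseteq> insert i (lower l)" using ideal_lower_Un[of "{i}" l] i(1) by simp
    show "insert i (lower l) \<subseteq> ideal \<Omega> r S"
      using lower_subset_ideal[OF dom] i S level_disjoint_lower[OF i(1)] by blast
  qed
  then show "card (ideal \<Omega> r S) = Suc (card (lower l))"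
    using finite_lower level_disjoint_lower[OF i(1)] by simp
qed

text \<open>\<open>T\<close> is to be the support of a word and \<open>U\<close> its support after a
  move by a word carried by \<open>insert i (lower l)\<close>. Changes within \<open>lower l\<close>
  do not matter, as \<open>T\<close> generates all of it. If \<open>i\<close> is already in the
  ideal, nothing can be gained; otherwise \<open>i\<close> enters and adds only itself, since all
  elements strictly below it are in \<open>lower l\<close>.\<close>

lemma card_ideal_modified:
  assumes dom: "dominated l" and i: "i \<in> level (Suc l)"
    and T: "T \<subseteq> \<Omega>" and U: "U \<subseteq> \<Omega>" and K: "\<not> ideal \<Omega> r T \<subseteq> lower l"
    and same: "U - insert i (lower l) = T - insert i (lower l)" and new: "i \<notin> T \<Longrightarrow> i \<in> U"
  shows "card (ideal \<Omega> r U) = Suc (card (ideal \<Omega> r T)) \<longleftrightarrow> i \<notin> ideal \<Omega> r T"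
proof -
  let ?K = "ideal \<Omega> r T"
  have lowK: "lower l \<subseteq> ?K"
  proof -
    obtain t where t: "t \<in> T" "t \<notin> lower l" using K ideal_subset_lower by blast
    then show ?thesis using lower_subset_ideal[OF dom] T by blast
  qed
  show ?thesis
  proof
    assume card: "card (ideal \<Omega> r U) = Suc (card ?K)"
    show "i \<notin> ?K"
    proof
      assume "i \<in> ?K"
      then have "U \<subseteq> ?K" using same lowK subset_ideal[OF T] by blast
      then have "ideal \<Omega> r U \<subseteq> ?K" using ideal_mono[of U ?K] ideal_idem[of T] by simp
      then have "card (ideal \<Omega> r U) \<le> card ?K" using card_mono[OF finite_ideal] by blast
      then show False using card by linarith
    qed
  next
    assume iK: "i \<notin> ?K"
    then have iT: "i \<notin> T" using subset_ideal[OF T] by blast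
    have i\<Omega>: "i \<in> \<Omega>" "i \<notin> lower l" using i level_disjoint_lower by (auto simp: level_def)
    have lowU: "insert i (lower l) \<subseteq> ideal \<Omega> r U"
      using lower_subset_ideal[OF dom i\<Omega> new[OF iT]] .
    have "ideal \<Omega> r U = insert i ?K"
    proof (intro equalityI subsetI)
      fix a assume "a \<in> ideal \<Omega> r U"
      then obtain b where b: "b \<in> U" "(a, b) \<in> r" "a \<in> \<Omega>" by (auto simp: ideal_def)
      consider "b = i" | "b \<in> lower l" | "b \<in> T" using b same by blast
      then show "a \<in> insert i ?K"
      proof cases
        case 1 then show ?thesis using below_level[OF i] b lowK by blast
      next
        case 2 then show ?thesis using lower_closed b lowK by blast
      next
        case 3 then show ?thesis using b by (auto simp: ideal_def)
      qed
    next
      fix a assume a: "a \<in> insert i ?K"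
      show "a \<in> ideal \<Omega> r U"
      proof (cases "a = i")
        case True then show ?thesis using lowU by blast
      next
        case False
        then obtain b where b: "b \<in> T" "(a, b) \<in> r" "a \<in> \<Omega>" using a by (auto simp: ideal_def)
        show ?thesis
        proof (cases "b \<in> lower l")
          case True then show ?thesis using lower_closed b lowU by blast
        next
          case False
          then have "b \<in> U" using b iT same by blast
          then show ?thesis using b by (auto simp: ideal_def)
        qed
      qed
    qed
    then show "card (ideal \<Omega> r U) = Suc (card ?K)" using iK finite_ideal by simp
  qed
qed

section \<open>Maximal elements and transforms of ideals\<close>

definition top_elements :: "'i set \<Rightarrow> 'i set" where
  "top_elements I = {i\<in>I. \<forall>j\<in>I. (i, j) \<in> r \<longrightarrow> j = i}"

lemma ex_top_above:
  assumes I: "I \<subseteq> \<Omega>" and x: "x \<in> I"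
  shows "\<exists>y\<in>top_elements I. (x, y) \<in> r"
proof -
  let ?S = "{y\<in>I. (x, y) \<in> r}"
  have fin: "finite ?S" using I finite_ground finite_subset by fastforce
  have "x \<in> ?S" using I x le_refl by blast
  then have "Max (chain_len \<Omega> r ` ?S) \<in> chain_len \<Omega> r ` ?S" using fin by (intro Max_in) auto
  then obtain y where y: "y \<in> ?S" "Max (chain_len \<Omega> r ` ?S) = chain_len \<Omega> r y" by blast
  have "j = y" if j: "j \<in> I" "(y, j) \<in> r" for j
  proof (rule ccontr)
    assume "j \<noteq> y"
    have "j \<in> ?S" using j y le_trans[of x y j] by blast
    then have "chain_len \<Omega> r j \<le> chain_len \<Omega> r y"
      using y(2) Max_ge[of "chain_len \<Omega> r ` ?S"] fin by force
    then show False using chain_len_strict_mono[OF j(2)] \<open>j \<noteq> y\<close> by force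
  qed
  then show ?thesis using y by (auto simp: top_elements_def)
qed

text \<open>A finite ideal is generated by its maximal elements and by no set that misses one of
  them. This makes the words generating \<open>I\<close> a product set.\<close>

lemma ideal_eq_iff_top_elements:
  assumes I: "ideal \<Omega> r I = I" and S: "S \<subseteq> \<Omega>"
  shows "ideal \<Omega> r S = I \<longleftrightarrow> S \<subseteq> I \<and> top_elements I \<subseteq> S"
proof
  assume eq: "ideal \<Omega> r S = I"
  have "i \<in> S" if "i \<in> top_elements I" for i
  proof -
    have "i \<in> ideal \<Omega> r S" using that eq by (simp add: top_elements_def)
    then obtain b where "b \<in> S" "(i, b) \<in> r" by (auto simp: ideal_def)
    then show ?thesis using that subset_ideal[OF S] eq by (auto simp: top_elements_def)
  qed
  then show "S \<subseteq> I \<and> top_elements I \<subseteq> S" using subset_ideal[OF S] eq by blast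
next
  assume S': "S \<subseteq> I \<and> top_elements I \<subseteq> S"
  have I\<Omega>: "I \<subseteq> \<Omega>" using I ideal_ground by blast
  show "ideal \<Omega> r S = I"
  proof
    show "ideal \<Omega> r S \<subseteq> I" using ideal_mono[of S I] S' I by simp
    show "I \<subseteq> ideal \<Omega> r S"
    proof
      fix x assume "x \<in> I"
      then obtain y where "y \<in> top_elements I" "(x, y) \<in> r" using ex_top_above[OF I\<Omega>] by blast
      then show "x \<in> ideal \<Omega> r S" using S' \<open>x \<in> I\<close> I\<Omega> by (auto simp: ideal_def)
    qed
  qed
qed

text \<open>The value at a character with support A of the Fourier transform of the set of words whose
  support generates the ideal I.\<close>

definition ideal_transform :: "('i \<Rightarrow> complex) \<Rightarrow> 'i set \<Rightarrow> 'i set \<Rightarrow> complex" where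
  "ideal_transform h I A =
     (\<Prod>i\<in>I. (if i \<in> A then 0 else h i) - (if i \<in> top_elements I then 1 else 0))"

definition ideals_of_card :: "nat \<Rightarrow> 'i set set" where
  "ideals_of_card k = {I. ideal \<Omega> r I = I \<and> card I = k}"

lemma ideals_of_card_subset: "I \<in> ideals_of_card k \<Longrightarrow> I \<subseteq> \<Omega>"
  using ideal_ground by (auto simp: ideals_of_card_def)

lemma finite_ideals_of_card: "finite (ideals_of_card k)"
  by (rule finite_subset[of _ "Pow \<Omega>"]) (use finite_ground ideals_of_card_subset in auto)

text \<open>The factor at \<open>a\<close> vanishes: \<open>a \<in> A\<close> removes the group
  order, and \<open>v\<close> prevents \<open>a\<close> from being maximal.\<close>

lemma ideal_transform_eq_0:
  assumes "ideal \<Omega> r I = I" "a \<in> A" "v \<in> I" "(a, v) \<in> r" "a \<noteq> v"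
  shows "ideal_transform h I A = 0"
proof -
  have "finite I" using assms(1) finite_ideal by metis
  moreover have "a \<in> I" using down_closedD assms(1,3,4) by blast
  moreover have "a \<notin> top_elements I" using assms by (auto simp: top_elements_def)
  ultimately show ?thesis unfolding ideal_transform_def using assms(2)
    by (intro prod_zero) (auto intro!: bexI[of _ a])
qed

end

section \<open>Ordinal sums of antichains\<close>

locale graded_poset = finite_poset +
  fixes lev :: "'a \<Rightarrow> nat"
  assumes le_iff_lev: "\<And>u v. u \<in> \<Omega> \<Longrightarrow> v \<in> \<Omega> \<Longrightarrow> (u, v) \<in> r \<longleftrightarrow> u = v \<or> lev u < lev v"
begin

definition floor_of :: "'a set \<Rightarrow> 'a set" where
  "floor_of A = {a\<in>A. \<forall>b\<in>A. lev a \<le> lev b}"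

text \<open>In the converse order only the lowest level of \<open>A\<close> matters: its elements,
  together with everything on higher levels, make up the generated ideal.\<close>

lemma filter_eq:
  assumes A: "A \<subseteq> \<Omega>" and a: "a \<in> floor_of A"
  shows "ideal \<Omega> (r\<inverse>) A = {u\<in>\<Omega>. lev a < lev u} \<union> floor_of A"
proof (intro equalityI subsetI)
  fix u assume "u \<in> ideal \<Omega> (r\<inverse>) A"
  then obtain b where b: "b \<in> A" "(b, u) \<in> r" "u \<in> \<Omega>" by (auto simp: ideal_def)
  have ab: "lev a \<le> lev b" using a b by (simp add: floor_of_def)
  have "b = u \<or> lev b < lev u" using b A le_iff_lev by blast
  then show "u \<in> {u\<in>\<Omega>. lev a < lev u} \<union> floor_of A"
  proof
    assume "b = u"
    show ?thesis
    proof (cases "lev a < lev u")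
      case False
      then have "lev u = lev a" using ab \<open>b = u\<close> by simp
      then show ?thesis using a b \<open>b = u\<close> by (auto simp: floor_of_def)
    qed (use b in auto)
  qed (use ab b in auto)
next
  fix u assume u: "u \<in> {u\<in>\<Omega>. lev a < lev u} \<union> floor_of A"
  show "u \<in> ideal \<Omega> (r\<inverse>) A"
  proof (cases "u \<in> floor_of A")
    case True then show ?thesis using A le_refl by (auto simp: ideal_def floor_of_def)
  next
    case False
    then have "u \<in> \<Omega>" "lev a < lev u" using u by auto
    then have "(a, u) \<in> r" using a A le_iff_lev by (auto simp: floor_of_def)
    then show ?thesis using a \<open>u \<in> \<Omega>\<close> by (auto simp: ideal_def floor_of_def)
  qed
qed

lemma ex_floor: "A \<subseteq> \<Omega> \<Longrightarrow> A \<noteq> {} \<Longrightarrow> \<exists>a. a \<in> floor_of A"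
  using ex_is_arg_min_if_finite[of A lev] finite_ground finite_subset[of A \<Omega>]
  by (auto simp: is_arg_min_def not_less floor_of_def)

text \<open>The filters are nested, and \<open>a\<close> is in the larger one only. Hence the dual
  weight determines the lowest level of a nonempty support.\<close>

lemma filter_card_less:
  assumes A: "A \<subseteq> \<Omega>" "a \<in> floor_of A" and B: "B \<subseteq> \<Omega>" "b \<in> floor_of B" and less: "lev a < lev b"
  shows "card (ideal \<Omega> (r\<inverse>) B) < card (ideal \<Omega> (r\<inverse>) A)"
proof (rule psubset_card_mono)
  show "finite (ideal \<Omega> (r\<inverse>) A)" using finite_ground by (simp add: ideal_def)
  have "lev u \<ge> lev b" if "u \<in> floor_of B" for u using B(2) that by (simp add: floor_of_def)
  then have sub: "ideal \<Omega> (r\<inverse>) B \<subseteq> {u\<in>\<Omega>. lev a < lev u}"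
    unfolding filter_eq[OF B] using less B(1) by (fastforce simp: floor_of_def)
  then show "ideal \<Omega> (r\<inverse>) B \<subset> ideal \<Omega> (r\<inverse>) A"
    unfolding filter_eq[OF A] using A(2) by auto
qed

text \<open>Nonempty \<open>A\<close> and \<open>B\<close> of equal dual weight have the same lowest
  level \<open>L\<close> and equally many elements on it. A permutation of \<open>L\<close> taking
  \<open>A \<inter> L\<close> to \<open>B \<inter> L\<close>, and fixing the rest, is an
  automorphism that preserves \<open>h\<close>, so it permutes the ideals of size \<open>k\<close>.
  It need not map \<open>A\<close> to \<open>B\<close>, but ideals reaching above \<open>L\<close>
  contribute 0 on both sides.\<close>

lemma sum_ideal_transform_cong:
  assumes h: "\<And>u v. u \<in> \<Omega> \<Longrightarrow> v \<in> \<Omega> \<Longrightarrow> lev u = lev v \<Longrightarrow> h u = h v"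
    and A: "A \<subseteq> \<Omega>" and B: "B \<subseteq> \<Omega>"
    and card: "card (ideal \<Omega> (r\<inverse>) A) = card (ideal \<Omega> (r\<inverse>) B)"
  shows "(\<Sum>I\<in>ideals_of_card k. ideal_transform h I A) = (\<Sum>I\<in>ideals_of_card k. ideal_transform h I B)"
proof -
  interpret dual: finite_poset \<Omega> "r\<inverse>"
    using finite_ground partial_order by unfold_locales simp_all
  \<comment> \<open>The empty set has no lowest level; it is recognised by dual weight 0.\<close>
  have empty: "S = {}" if "S \<subseteq> \<Omega>" "card (ideal \<Omega> (r\<inverse>) S) = 0" for S
    using that dual.subset_ideal[of S] dual.finite_ideal[of S] by auto
  show ?thesis
  proof (cases "A = {} \<or> B = {}")
    case True
    have "card (ideal \<Omega> (r\<inverse>) {}) = 0" by (simp add: ideal_def)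
    then have "A = {} \<and> B = {}" using True card empty[OF A] empty[OF B] by auto
    then show ?thesis by simp
  next
    case False
    then obtain a b where a: "a \<in> floor_of A" and b: "b \<in> floor_of B"
      using ex_floor[OF A] ex_floor[OF B] by blast
    have lev: "lev a = lev b"
      using filter_card_less[OF A a B b] filter_card_less[OF B b A a] card by linarith
    define L where "L = {u\<in>\<Omega>. lev u = lev a}"
    have finL: "finite L" using finite_ground by (simp add: L_def)
    have floorA: "floor_of A = A \<inter> L" and lowA: "\<And>u. u \<in> A \<Longrightarrow> lev a \<le> lev u"
      using a A by (auto simp: floor_of_def L_def intro: antisym)
    have floorB: "floor_of B = B \<inter> L" and lowB: "\<And>u. u \<in> B \<Longrightarrow> lev a \<le> lev u"
      using b B lev by (auto simp: floor_of_def L_def intro: antisym)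
    let ?U = "{u\<in>\<Omega>. lev a < lev u}"
    have "card (?U \<union> (A \<inter> L)) = card (?U \<union> (B \<inter> L))"
      using card unfolding filter_eq[OF A a] filter_eq[OF B b] floorA floorB lev[symmetric] .
    moreover have "card (?U \<union> (S \<inter> L)) = card ?U + card (S \<inter> L)" for S
      using finite_ground finL by (intro card_Un_disjoint) (auto simp: L_def)
    ultimately have cardL: "card (A \<inter> L) = card (B \<inter> L)" by simp
    then have cardL': "card (L - A) = card (L - B)"
      using finL by (metis card_Diff_subset_Int finite_Int Int_commute)
    obtain f g where f: "bij_betw f (A \<inter> L) (B \<inter> L)" and g: "bij_betw g (L - A) (L - B)"
      using finite_same_card_bij[OF _ _ cardL] finite_same_card_bij[OF _ _ cardL'] finL by blast
    define p where "p u = (if u \<in> A \<inter> L then f u else if u \<in> L then g u else u)" for u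
    have p1: "bij_betw p (A \<inter> L) (B \<inter> L)" using f by (rule bij_betw_cong[THEN iffD1, rotated]) (simp add: p_def)
    have p2: "bij_betw p (L - A) (L - B)" using g by (rule bij_betw_cong[THEN iffD1, rotated]) (simp add: p_def)
    have p3: "bij_betw p (\<Omega> - L) (\<Omega> - L)" using bij_betw_id by (rule bij_betw_cong[THEN iffD1, rotated]) (simp add: p_def)
    have "bij_betw p ((A \<inter> L) \<union> (L - A)) ((B \<inter> L) \<union> (L - B))"
      by (rule bij_betw_combine[OF p1 p2]) auto
    moreover have "(S \<inter> L) \<union> (L - S) = L" for S by blast
    ultimately have pL: "bij_betw p L L" by simp
    have "bij_betw p (L \<union> (\<Omega> - L)) (L \<union> (\<Omega> - L))"
      by (rule bij_betw_combine[OF pL p3]) auto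
    moreover have "L \<union> (\<Omega> - L) = \<Omega>" by (auto simp: L_def)
    ultimately have p\<Omega>: "bij_betw p \<Omega> \<Omega>" by simp
    have p_in: "p u \<in> \<Omega>" if "u \<in> \<Omega>" for u using p\<Omega> that bij_betwE by blast
    have p_inj: "p u = p v \<longleftrightarrow> u = v" if "u \<in> \<Omega>" "v \<in> \<Omega>" for u v
      using p\<Omega> that by (auto simp: bij_betw_def inj_on_def)
    have p_lev: "lev (p u) = lev u" if "u \<in> \<Omega>" for u
    proof (cases "u \<in> L")
      case True
      then have "p u \<in> L" using pL bij_betwE by blast
      then show ?thesis using True by (simp add: L_def)
    qed (simp add: p_def)
    have p_le: "(p u, p v) \<in> r \<longleftrightarrow> (u, v) \<in> r" if "u \<in> \<Omega>" "v \<in> \<Omega>" for u v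
      using that p_in p_lev p_inj le_iff_lev by simp
    have p_mem: "p u \<in> B \<longleftrightarrow> u \<in> A" if "u \<in> L" for u
    proof (cases "u \<in> A")
      case True then show ?thesis using that bij_betwE[OF p1] by blast
    next
      case False then show ?thesis using that bij_betwE[OF p2] by blast
    qed
    have p_ideal: "p ` I \<in> ideals_of_card k" if I: "I \<in> ideals_of_card k" for I
    proof -
      have I\<Omega>: "I \<subseteq> \<Omega>" using ideals_of_card_subset I .
      have "c \<in> p ` I" if b: "b \<in> I" and c: "(c, p b) \<in> r" for b c
      proof -
        have "c \<in> p ` \<Omega>" using le_ground[OF c] p\<Omega> by (simp add: bij_betw_def)
        then obtain d where d: "d \<in> \<Omega>" "c = p d" by blast
        then have "(d, b) \<in> r" using c p_le b I\<Omega> by blast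
        then show ?thesis using d b I down_closedD[of I b d] by (auto simp: ideals_of_card_def)
      qed
      then have "ideal \<Omega> r (p ` I) = p ` I"
        unfolding ideal_eq_self_iff using p_in I\<Omega> by blast
      moreover have "card (p ` I) = card I"
        using I\<Omega> p_inj by (intro card_image inj_onI) blast
      ultimately show ?thesis using I by (simp add: ideals_of_card_def)
    qed
    have "inj_on (image p) (ideals_of_card k)"
      by (rule inj_on_subset[OF inj_on_image_Pow]) (use p\<Omega> ideals_of_card_subset in \<open>auto simp: bij_betw_def\<close>)
    moreover have "image p ` ideals_of_card k \<subseteq> ideals_of_card k" using p_ideal by blast
    ultimately have bij: "bij_betw (image p) (ideals_of_card k) (ideals_of_card k)"
      unfolding bij_betw_def using endo_inj_surj[OF finite_ideals_of_card] by blast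
    have "ideal_transform h (p ` I) B = ideal_transform h I A" if I: "I \<in> ideals_of_card k" for I
    proof (cases "\<exists>v\<in>I. lev a < lev v")
      case True
      then obtain v where v: "v \<in> I" "lev a < lev v" by blast
      have v\<Omega>: "v \<in> \<Omega>" using ideals_of_card_subset[OF I] v by blast
      have mem: "a \<in> A" "a \<in> \<Omega>" "b \<in> B" "b \<in> \<Omega>" using a b A B by (auto simp: floor_of_def)
      have "ideal_transform h I A = 0"
        using I v v\<Omega> mem le_iff_lev[of a v]
        by (intro ideal_transform_eq_0[of I a A v]) (auto simp: ideals_of_card_def)
      moreover have "ideal_transform h (p ` I) B = 0"
        using p_ideal[OF I] v v\<Omega> mem le_iff_lev[of b "p v"] p_lev[of v] p_in[of v] lev
        by (intro ideal_transform_eq_0[of "p ` I" b B "p v"]) (auto simp: ideals_of_card_def)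
      ultimately show ?thesis by simp
    next
      case False
      have I\<Omega>: "I \<subseteq> \<Omega>" using ideals_of_card_subset I .
      \<comment> \<open>Below the level \<open>L\<close> there are no elements of \<open>A\<close>
        or of \<open>B\<close>, and this ideal does not reach above \<open>L\<close>.\<close>
      have mem: "p i \<in> B \<longleftrightarrow> i \<in> A" if i: "i \<in> I" for i
      proof (cases "lev i = lev a")
        case True then show ?thesis using p_mem i I\<Omega> by (auto simp: L_def)
      next
        case ne: False
        then have "lev i < lev a" using False i by force
        moreover have "lev (p i) = lev i" using p_lev i I\<Omega> by blast
        ultimately show ?thesis using lowA[of i] lowB[of "p i"] by auto
      qed
      have top: "p i \<in> top_elements (p ` I) \<longleftrightarrow> i \<in> top_elements I" if i: "i \<in> I" for i
        using i I\<Omega> p_le p_inj by (auto simp: top_elements_def subset_iff)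
      have "inj_on p I" using I\<Omega> p_inj by (intro inj_onI) blast
      then have "ideal_transform h (p ` I) B =
        (\<Prod>i\<in>I. (if p i \<in> B then 0 else h (p i)) - (if p i \<in> top_elements (p ` I) then 1 else 0))"
        unfolding ideal_transform_def by (simp add: prod.reindex)
      also have "\<dots> = ideal_transform h I A"
        unfolding ideal_transform_def
      proof (rule prod.cong)
        fix i assume i: "i \<in> I"
        have "h (p i) = h i" using h[of "p i" i] p_in p_lev i I\<Omega> by blast
        then show "(if p i \<in> B then 0 else h (p i)) - (if p i \<in> top_elements (p ` I) then 1 else 0)
          = (if i \<in> A then 0 else h i) - (if i \<in> top_elements I then 1 else 0)"
          using mem[OF i] top[OF i] by simp
      qed simp
      finally show ?thesis .
    qed
    then have "(\<Sum>I\<in>ideals_of_card k. ideal_transform h I A)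
        = (\<Sum>I\<in>ideals_of_card k. ideal_transform h (p ` I) B)" by simp
    also have "\<dots> = (\<Sum>I\<in>ideals_of_card k. ideal_transform h I B)"
      using bij by (rule sum.reindex_bij_betw)
    finally show ?thesis .
  qed
qed

end

section \<open>Weights of words and of characters\<close>

locale poset_code = finite_poset \<Omega> r for \<Omega> :: "'i set" and r +
  fixes H :: "'i \<Rightarrow> ('a, 'c) monoid_scheme"
  assumes comm_group_H: "\<And>i. i \<in> \<Omega> \<Longrightarrow> comm_group (H i)"
    and finite_H: "\<And>i. i \<in> \<Omega> \<Longrightarrow> finite (carrier (H i))"
    and card_H: "\<And>i. i \<in> \<Omega> \<Longrightarrow> card (carrier (H i)) \<ge> 2"
begin

abbreviation words :: "('i \<Rightarrow> 'a) set" where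
  "words \<equiv> prod_carrier \<Omega> H"

abbreviation chars :: "('i \<Rightarrow> 'a \<Rightarrow> complex) set" where
  "chars \<equiv> prod_chars \<Omega> H"

abbreviation supp :: "('i \<Rightarrow> 'a) \<Rightarrow> 'i set" where
  "supp \<equiv> supp_word \<Omega> H"

definition weight :: "('i \<Rightarrow> 'a) \<Rightarrow> nat" where
  "weight \<beta> = card (ideal \<Omega> r (supp \<beta>))"

definition dual_weight :: "('i \<Rightarrow> 'a \<Rightarrow> complex) \<Rightarrow> nat" where
  "dual_weight \<alpha> = card (ideal \<Omega> (r\<inverse>) (supp_char \<Omega> H \<alpha>))"

lemma Q_words_eq: "Q_words \<Omega> H r = kernel_partition words weight"
  by (simp add: Q_words_def weight_partition_def kernel_partition_def weight_def)

lemma Q_chars_eq: "Q_chars \<Omega> H (r\<inverse>) = kernel_partition chars dual_weight"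
  by (simp add: Q_chars_def weight_partition_def kernel_partition_def dual_weight_def)

lemma group_H: "i \<in> \<Omega> \<Longrightarrow> group (H i)"
  using comm_group_H comm_group.axioms(2) by blast

lemma one_in_H: "i \<in> \<Omega> \<Longrightarrow> \<one>\<^bsub>H i\<^esub> \<in> carrier (H i)"
  using group_H group.is_monoid monoid.one_closed by blast

lemma words_mem: "\<beta> \<in> words \<Longrightarrow> i \<in> \<Omega> \<Longrightarrow> \<beta> i \<in> carrier (H i)"
  by (auto simp: prod_carrier_def)

lemma chars_mem: "\<alpha> \<in> chars \<Longrightarrow> i \<in> \<Omega> \<Longrightarrow> \<alpha> i \<in> characters (H i)"
  by (auto simp: prod_chars_def)

lemma finite_words: "finite words"
  unfolding prod_carrier_def using finite_ground finite_H by (intro finite_PiE)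

lemma finite_characters_H: "i \<in> \<Omega> \<Longrightarrow> finite (characters (H i))"
  using comm_group.finite_characters comm_group_H finite_H by blast

lemma finite_chars: "finite chars"
  unfolding prod_chars_def using finite_ground finite_characters_H by (intro finite_PiE)

lemma supp_ground: "supp \<beta> \<subseteq> \<Omega>"
  by (auto simp: supp_word_def)

lemma ex_nontrivial:
  assumes "i \<in> \<Omega>"
  shows "\<exists>a. a \<in> carrier (H i) \<and> a \<noteq> \<one>\<^bsub>H i\<^esub>"
proof (rule ccontr)
  assume "\<not> ?thesis"
  then have "carrier (H i) \<subseteq> {\<one>\<^bsub>H i\<^esub>}" by blast
  then have "card (carrier (H i)) \<le> 1" using card_mono[of "{\<one>\<^bsub>H i\<^esub>}"] by fastforce
  then show False using card_H[OF assms] by simp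
qed

lemma ex_word_with_supp:
  assumes "A \<subseteq> \<Omega>"
  shows "\<exists>\<beta>\<in>words. supp \<beta> = A"
proof -
  obtain a where a: "\<And>i. i \<in> \<Omega> \<Longrightarrow> a i \<in> carrier (H i) \<and> a i \<noteq> \<one>\<^bsub>H i\<^esub>"
    using ex_nontrivial by metis
  show ?thesis
    by (rule bexI[of _ "\<lambda>i\<in>\<Omega>. if i \<in> A then a i else \<one>\<^bsub>H i\<^esub>"])
      (use a assms one_in_H in \<open>auto simp: supp_word_def prod_carrier_def\<close>)
qed

lemma ex_char_with_supp:
  assumes "A \<subseteq> \<Omega>"
  shows "\<exists>\<alpha>\<in>chars. supp_char \<Omega> H \<alpha> = A"
proof -
  have "\<exists>\<chi>. \<chi> \<in> characters (H i) \<and> \<chi> \<noteq> trivial_character (H i)" if i: "i \<in> \<Omega>" for i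
  proof -
    obtain a where a: "a \<in> carrier (H i)" "a \<noteq> \<one>\<^bsub>H i\<^esub>" using ex_nontrivial[OF i] by blast
    obtain \<chi> where \<chi>: "\<chi> \<in> characters (H i)" "\<chi> a \<noteq> 1"
      using comm_group.ex_separating_character[OF comm_group_H[OF i] finite_H[OF i] a] .
    then have "\<chi> \<noteq> trivial_character (H i)" using a by (auto simp: trivial_character_def)
    with \<chi> show ?thesis by blast
  qed
  then obtain c where c: "\<And>i. i \<in> \<Omega> \<Longrightarrow> c i \<in> characters (H i) \<and> c i \<noteq> trivial_character (H i)"
    by metis
  have t: "trivial_character (H i) \<in> characters (H i)" if "i \<in> \<Omega>" for i
    using comm_group.trivial_in_characters[OF comm_group_H[OF that]] .
  show ?thesis
    by (rule bexI[of _ "\<lambda>i\<in>\<Omega>. if i \<in> A then c i else trivial_character (H i)"])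
      (use c t assms in \<open>auto simp: supp_char_def prod_chars_def\<close>)
qed

lemma range_weight: "weight ` words = {..card \<Omega>}"
  unfolding weight_def[abs_def] using supp_ground ex_word_with_supp by (rule range_ideal_card)

lemma range_dual_weight: "dual_weight ` chars = {..card \<Omega>}"
proof -
  interpret dual: finite_poset \<Omega> "r\<inverse>"
    using finite_ground partial_order by unfold_locales simp_all
  show ?thesis
    unfolding dual_weight_def[abs_def] using _ ex_char_with_supp
    by (rule dual.range_ideal_card) (auto simp: supp_char_def)
qed

section \<open>Orthogonality and convolution on words\<close>

definition N :: complex where
  "N = (\<Prod>i\<in>\<Omega>. of_nat (card (characters (H i))))"

lemma N_nonzero: "N \<noteq> 0"
proof -
  have "card (characters (H i)) \<noteq> 0" if "i \<in> \<Omega>" for i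
    using comm_group.trivial_in_characters[OF comm_group_H[OF that]] finite_characters_H[OF that] by auto
  then show ?thesis using finite_ground by (simp add: N_def)
qed

text \<open>The word that multiplies \<open>\<beta>\<close> to \<open>\<gamma>\<close>, hence the
  second factor in a convolution at \<open>\<gamma>\<close>.\<close>

definition quot :: "('i \<Rightarrow> 'a) \<Rightarrow> ('i \<Rightarrow> 'a) \<Rightarrow> 'i \<Rightarrow> 'a" where
  "quot \<beta> \<gamma> = (\<lambda>i\<in>\<Omega>. inv\<^bsub>H i\<^esub> (\<beta> i) \<otimes>\<^bsub>H i\<^esub> \<gamma> i)"

lemma quot_in_words: "\<beta> \<in> words \<Longrightarrow> \<gamma> \<in> words \<Longrightarrow> quot \<beta> \<gamma> \<in> words"
  unfolding quot_def prod_carrier_def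
  by (auto intro!: monoid.m_closed group.is_monoid group_H group.inv_closed)

lemma supp_quot:
  assumes "\<beta> \<in> words" "\<gamma> \<in> words"
  shows "supp (quot \<beta> \<gamma>) = {i\<in>\<Omega>. \<beta> i \<noteq> \<gamma> i}"
proof -
  have "quot \<beta> \<gamma> i = \<one>\<^bsub>H i\<^esub> \<longleftrightarrow> \<beta> i = \<gamma> i" if i: "i \<in> \<Omega>" for i
  proof -
    interpret group "H i" using group_H[OF i] .
    show ?thesis using words_mem[OF assms(1) i] words_mem[OF assms(2) i] i
        inv_solve_left'[of "\<one>\<^bsub>H i\<^esub>" "\<beta> i" "\<gamma> i"] by (auto simp: quot_def)
  qed
  then show ?thesis by (auto simp: supp_word_def)
qed

text \<open>The sum over the product of the character groups factors into sums over the single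
  groups.\<close>

lemma sum_chars_triple:
  assumes \<beta>: "\<beta> \<in> words" and \<beta>': "\<beta>' \<in> words" and \<gamma>: "\<gamma> \<in> words"
  shows "(\<Sum>\<alpha>\<in>chars. char_eval \<Omega> \<alpha> \<beta> * char_eval \<Omega> \<alpha> \<beta>' * cnj (char_eval \<Omega> \<alpha> \<gamma>))
       = (if \<beta>' = quot \<beta> \<gamma> then N else 0)"
proof -
  have "(\<Sum>\<alpha>\<in>chars. char_eval \<Omega> \<alpha> \<beta> * char_eval \<Omega> \<alpha> \<beta>' * cnj (char_eval \<Omega> \<alpha> \<gamma>))
     = (\<Sum>\<alpha>\<in>chars. \<Prod>i\<in>\<Omega>. \<alpha> i (\<beta> i) * \<alpha> i (\<beta>' i) * cnj (\<alpha> i (\<gamma> i)))"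
    by (simp add: char_eval_def prod.distrib)
  also have "\<dots> = (\<Prod>i\<in>\<Omega>. \<Sum>\<chi>\<in>characters (H i). \<chi> (\<beta> i) * \<chi> (\<beta>' i) * cnj (\<chi> (\<gamma> i)))"
    unfolding prod_chars_def using finite_ground finite_characters_H by (intro prod_sum_PiE[symmetric])
  also have "\<dots> = (\<Prod>i\<in>\<Omega>. if \<beta>' i = inv\<^bsub>H i\<^esub> (\<beta> i) \<otimes>\<^bsub>H i\<^esub> \<gamma> i
                       then of_nat (card (characters (H i))) else 0)"
    by (intro prod.cong refl comm_group.sum_characters_triple comm_group_H finite_H
        words_mem[OF \<beta>] words_mem[OF \<beta>'] words_mem[OF \<gamma>])
  also have "\<dots> = (if \<beta>' = quot \<beta> \<gamma> then N else 0)"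
  proof (cases "\<beta>' = quot \<beta> \<gamma>")
    case True then show ?thesis by (simp add: N_def quot_def)
  next
    case False
    \<comment> \<open>Distinct extensional words differ at a coordinate in \<open>\<Omega>\<close>,
      whose factor is 0.\<close>
    have "\<beta>' \<in> extensional \<Omega>" "quot \<beta> \<gamma> \<in> extensional \<Omega>"
      using \<beta>' by (auto simp: prod_carrier_def quot_def PiE_def)
    then obtain i where "i \<in> \<Omega>" "\<beta>' i \<noteq> quot \<beta> \<gamma> i" using False extensionalityI by metis
    then have "(\<Prod>i\<in>\<Omega>. if \<beta>' i = inv\<^bsub>H i\<^esub> (\<beta> i) \<otimes>\<^bsub>H i\<^esub> \<gamma> i
                       then of_nat (card (characters (H i))) else 0) = (0::complex)"
      using finite_ground by (intro prod_zero) (auto simp: quot_def intro!: bexI[of _ i])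
    then show ?thesis using False by simp
  qed
  finally show ?thesis .
qed

sublocale fourier_pairing words chars "char_eval \<Omega>" N
proof
  fix b d assume b: "b \<in> words" and d: "d \<in> words"
  \<comment> \<open>With the identity word as first argument, the triple sum becomes the
    orthogonality relation.\<close>
  define u where "u = (\<lambda>i\<in>\<Omega>. \<one>\<^bsub>H i\<^esub>)"
  have u: "u \<in> words" using one_in_H by (auto simp: u_def prod_carrier_def)
  have "char_eval \<Omega> \<alpha> u = 1" if "\<alpha> \<in> chars" for \<alpha>
    unfolding char_eval_def u_def
    using comm_group.characters_one[OF comm_group_H chars_mem[OF that]] by simp
  then have "(\<Sum>\<alpha>\<in>chars. char_eval \<Omega> \<alpha> b * cnj (char_eval \<Omega> \<alpha> d))
    = (\<Sum>\<alpha>\<in>chars. char_eval \<Omega> \<alpha> u * char_eval \<Omega> \<alpha> b * cnj (char_eval \<Omega> \<alpha> d))" by simp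
  also have "\<dots> = (if b = quot u d then N else 0)" using u b d by (rule sum_chars_triple)
  also have "quot u d = d"
  proof
    fix i
    show "quot u d i = d i"
    proof (cases "i \<in> \<Omega>")
      case True
      interpret group "H i" using group_H[OF True] .
      show ?thesis using True words_mem[OF d True] by (simp add: quot_def u_def)
    next
      case False
      then show ?thesis using d by (auto simp: quot_def prod_carrier_def PiE_def extensional_def)
    qed
  qed
  finally show "(\<Sum>y\<in>chars. char_eval \<Omega> y b * cnj (char_eval \<Omega> y d)) = (if b = d then N else 0)" .
qed (use finite_words finite_chars N_nonzero in auto)

text \<open>The cardinality is the value at \<open>\<gamma>\<close> of the convolution of two weight
  class indicators. The transform turns the convolution into a product, and inversion brings it
  back.\<close>

lemma convolution_number:
  assumes \<gamma>: "\<gamma> \<in> words"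
  shows "N * of_nat (card {\<beta>\<in>words. weight \<beta> = a \<and> weight (quot \<beta> \<gamma>) = b})
    = (\<Sum>\<alpha>\<in>chars. class_sum words weight (char_eval \<Omega> \<alpha>) a * class_sum words weight (char_eval \<Omega> \<alpha>) b
         * cnj (char_eval \<Omega> \<alpha> \<gamma>))"
proof -
  let ?W = "\<lambda>k. {\<beta>\<in>words. weight \<beta> = k}" and ?e = "char_eval \<Omega>"
  have "(\<Sum>\<alpha>\<in>chars. class_sum words weight (?e \<alpha>) a * class_sum words weight (?e \<alpha>) b * cnj (?e \<alpha> \<gamma>))
     = (\<Sum>\<alpha>\<in>chars. \<Sum>\<beta>\<in>?W a. \<Sum>\<beta>'\<in>?W b. ?e \<alpha> \<beta> * ?e \<alpha> \<beta>' * cnj (?e \<alpha> \<gamma>))"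
    unfolding class_sum_def sum_product unfolding sum_distrib_right ..
  also have "\<dots> = (\<Sum>\<beta>\<in>?W a. \<Sum>\<beta>'\<in>?W b. \<Sum>\<alpha>\<in>chars. ?e \<alpha> \<beta> * ?e \<alpha> \<beta>' * cnj (?e \<alpha> \<gamma>))"
    by (subst sum.swap) (intro sum.cong refl sum.swap)
  also have "\<dots> = (\<Sum>\<beta>\<in>?W a. \<Sum>\<beta>'\<in>?W b. if \<beta>' = quot \<beta> \<gamma> then N else 0)"
    using \<gamma> by (intro sum.cong refl sum_chars_triple) auto
  also have "\<dots> = (\<Sum>\<beta>\<in>?W a. if weight (quot \<beta> \<gamma>) = b then N else 0)"
    using finite_words quot_in_words \<gamma> by (intro sum.cong refl) simp
  also have "\<dots> = (\<Sum>\<beta> | \<beta> \<in> ?W a \<and> weight (quot \<beta> \<gamma>) = b. N)"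
    using finite_words by (intro sum.inter_filter[symmetric]) simp
  also have "{\<beta>. \<beta> \<in> ?W a \<and> weight (quot \<beta> \<gamma>) = b} = {\<beta>\<in>words. weight \<beta> = a \<and> weight (quot \<beta> \<gamma>) = b}"
    by blast
  finally show ?thesis by simp
qed

text \<open>The product of two class transforms is constant on the blocks of the dual partition.
  Reflexivity makes its inverse transform depend on the weight alone.\<close>

lemma convolution_number_cong:
  assumes refl: "fourier_reflexive \<Omega> H (Q_words \<Omega> H r)"
    and \<gamma>: "\<gamma> \<in> words" and \<delta>: "\<delta> \<in> words" and wt: "weight \<gamma> = weight \<delta>"
  shows "card {\<beta>\<in>words. weight \<beta> = a \<and> weight (quot \<beta> \<gamma>) = b}
       = card {\<beta>\<in>words. weight \<beta> = a \<and> weight (quot \<beta> \<delta>) = b}"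
proof -
  define g where "g \<alpha> = restrict (class_sum words weight (char_eval \<Omega> \<alpha>)) (weight ` words)" for \<alpha>
  have "kernel_partition words (\<lambda>\<beta>. restrict (class_sum chars g (\<lambda>\<alpha>. char_eval \<Omega> \<alpha> \<beta>)) (g ` chars))
      = kernel_partition words weight"
    using refl unfolding fourier_reflexive_def dual_of_chars_def dual_of_words_def Q_words_eq
      dual_kernel_partition g_def .
  then have "restrict (class_sum chars g (\<lambda>\<alpha>. char_eval \<Omega> \<alpha> \<gamma>)) (g ` chars)
      = restrict (class_sum chars g (\<lambda>\<alpha>. char_eval \<Omega> \<alpha> \<delta>)) (g ` chars)"
    unfolding kernel_partition_eq_iff using \<gamma> \<delta> wt by blast
  then have eq: "class_sum chars g (\<lambda>\<alpha>. char_eval \<Omega> \<alpha> \<gamma>) v = class_sum chars g (\<lambda>\<alpha>. char_eval \<Omega> \<alpha> \<delta>) v"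
    if "v \<in> g ` chars" for v using that unfolding restrict_eq_iff by blast
  \<comment> \<open>\<open>c\<close> reads the entries \<open>a\<close> and \<open>b\<close> off the
    tuple \<open>g \<alpha>\<close>; the default 0 is the class sum of a weight that does not
    occur.\<close>
  define c where "c \<phi> = (if a \<in> weight ` words then \<phi> a else 0) * (if b \<in> weight ` words then \<phi> b else 0)"
    for \<phi> :: "nat \<Rightarrow> complex"
  have zero: "class_sum words weight (char_eval \<Omega> \<alpha>) k = 0" if "k \<notin> weight ` words" for \<alpha> k
    unfolding class_sum_def using that by (intro sum.neutral) auto
  have c: "c (g \<alpha>) = class_sum words weight (char_eval \<Omega> \<alpha>) a * class_sum words weight (char_eval \<Omega> \<alpha>) b" for \<alpha>
    by (auto simp: c_def g_def zero)
  have "N * of_nat (card {\<beta>\<in>words. weight \<beta> = a \<and> weight (quot \<beta> \<gamma>) = b})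
      = N * of_nat (card {\<beta>\<in>words. weight \<beta> = a \<and> weight (quot \<beta> \<delta>) = b})"
    unfolding convolution_number[OF \<gamma>] convolution_number[OF \<delta>] c[symmetric]
    using eq by (rule class_sum_cnj_cong)
  then show ?thesis using N_nonzero by simp
qed

text \<open>The first condition places \<open>\<beta>\<close> on \<open>lower l\<close> and exactly
  one \<open>i\<close> of the next level, with \<open>\<beta> i\<close> not the identity. The second
  then says that \<open>i\<close> is outside the ideal of \<open>\<gamma>\<close>. The entries on
  \<open>lower l\<close> are free.\<close>

lemma count_moves:
  assumes dom: "dominated l" and \<gamma>: "\<gamma> \<in> words" and K: "\<not> ideal \<Omega> r (supp \<gamma>) \<subseteq> lower l"
  shows "card {\<beta>\<in>words. weight \<beta> = Suc (card (lower l)) \<and> weight (quot \<beta> \<gamma>) = Suc (weight \<gamma>)}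
    = (\<Prod>j\<in>lower l. card (carrier (H j)))
      * (\<Sum>i\<in>level (Suc l) - ideal \<Omega> r (supp \<gamma>). card (carrier (H i)) - 1)"
proof -
  let ?K = "ideal \<Omega> r (supp \<gamma>)" and ?M = "level (Suc l)"
  define B where "B i = (\<Pi>\<^sub>E j\<in>\<Omega>. if j = i then carrier (H j) - {\<one>\<^bsub>H j\<^esub>}
      else if j \<in> lower l then carrier (H j) else {\<one>\<^bsub>H j\<^esub>})" for i
  have M\<Omega>: "?M \<subseteq> \<Omega>" by (auto simp: level_def)
  have low\<Omega>: "lower l \<subseteq> \<Omega>" by (auto simp: lower_def)
  have B_iff: "\<beta> \<in> B i \<longleftrightarrow> \<beta> \<in> words \<and> i \<in> supp \<beta> \<and> supp \<beta> \<subseteq> insert i (lower l)"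
    if i: "i \<in> ?M" for i \<beta>
  proof -
    have "i \<in> \<Omega>" using i M\<Omega> by blast
    then show ?thesis
      unfolding B_def prod_carrier_def supp_word_def PiE_iff using one_in_H
      by (auto split: if_splits)
  qed
  have "{\<beta>\<in>words. weight \<beta> = Suc (card (lower l)) \<and> weight (quot \<beta> \<gamma>) = Suc (weight \<gamma>)}
      = (\<Union>i\<in>?M - ?K. B i)"
  proof -
    have step: "weight (quot \<beta> \<gamma>) = Suc (weight \<gamma>) \<longleftrightarrow> i \<notin> ?K"
      if \<beta>: "\<beta> \<in> words" and i: "i \<in> ?M" "i \<in> supp \<beta>" "supp \<beta> \<subseteq> insert i (lower l)" for \<beta> i
      unfolding weight_def
    proof (rule card_ideal_modified[OF dom i(1) supp_ground supp_ground K])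
      show "supp (quot \<beta> \<gamma>) - insert i (lower l) = supp \<gamma> - insert i (lower l)"
        unfolding supp_quot[OF \<beta> \<gamma>] using i(3) by (auto simp: supp_word_def)
      show "i \<notin> supp \<gamma> \<Longrightarrow> i \<in> supp (quot \<beta> \<gamma>)"
        unfolding supp_quot[OF \<beta> \<gamma>] using i(2) by (auto simp: supp_word_def)
    qed
    have first: "weight \<beta> = Suc (card (lower l)) \<longleftrightarrow> (\<exists>i\<in>?M. i \<in> supp \<beta> \<and> supp \<beta> \<subseteq> insert i (lower l))" for \<beta>
      unfolding weight_def using dom supp_ground by (rule card_ideal_eq_Suc_lower_iff)
    show ?thesis
    proof (intro equalityI subsetI)
      fix \<beta> assume "\<beta> \<in> {\<beta>\<in>words. weight \<beta> = Suc (card (lower l)) \<and> weight (quot \<beta> \<gamma>) = Suc (weight \<gamma>)}"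
      then obtain i where "\<beta> \<in> words" "i \<in> ?M" "i \<in> supp \<beta>" "supp \<beta> \<subseteq> insert i (lower l)"
        "weight (quot \<beta> \<gamma>) = Suc (weight \<gamma>)" using first by blast
      then show "\<beta> \<in> (\<Union>i\<in>?M - ?K. B i)" using step[of \<beta> i] B_iff[of i \<beta>] by blast
    next
      fix \<beta> assume "\<beta> \<in> (\<Union>i\<in>?M - ?K. B i)"
      then obtain i where "i \<in> ?M" "i \<notin> ?K" "\<beta> \<in> B i" by blast
      then show "\<beta> \<in> {\<beta>\<in>words. weight \<beta> = Suc (card (lower l)) \<and> weight (quot \<beta> \<gamma>) = Suc (weight \<gamma>)}"
        using step[of \<beta> i] B_iff[of i \<beta>] first by blast
    qed
  qed
  also have "card \<dots> = (\<Sum>i\<in>?M - ?K. card (B i))"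
  proof (rule card_UN_disjoint)
    show "finite (?M - ?K)" using finite_level by simp
    show "\<forall>i\<in>?M - ?K. finite (B i)"
    proof
      fix i assume "i \<in> ?M - ?K"
      then have "B i \<subseteq> words" using B_iff by blast
      then show "finite (B i)" using finite_words finite_subset by blast
    qed
    \<comment> \<open>A common word would have \<open>i\<close> in its support, hence in
      \<open>insert j (lower l)\<close>.\<close>
    show "\<forall>i\<in>?M - ?K. \<forall>j\<in>?M - ?K. i \<noteq> j \<longrightarrow> B i \<inter> B j = {}"
      using B_iff level_disjoint_lower by blast
  qed
  also have "\<dots> = (\<Sum>i\<in>?M - ?K. (\<Prod>j\<in>lower l. card (carrier (H j))) * (card (carrier (H i)) - 1))"
  proof (rule sum.cong)
    fix i assume "i \<in> ?M - ?K"
    then have i: "i \<in> \<Omega>" "i \<notin> lower l" using M\<Omega> level_disjoint_lower by blast+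
    have "card (B i) = (\<Prod>j\<in>\<Omega>. if j = i then card (carrier (H j)) - 1
        else if j \<in> lower l then card (carrier (H j)) else 1)"
      unfolding B_def using finite_ground finite_H one_in_H
      by (subst card_PiE) (auto intro!: prod.cong simp: card_Diff_singleton)
    also have "\<dots> = (\<Prod>j\<in>insert i (lower l). if j = i then card (carrier (H j)) - 1
        else if j \<in> lower l then card (carrier (H j)) else 1)"
      using finite_ground i low\<Omega> by (intro prod.mono_neutral_right) auto
    also have "\<dots> = (card (carrier (H i)) - 1) * (\<Prod>j\<in>lower l. if j = i then card (carrier (H j)) - 1
        else if j \<in> lower l then card (carrier (H j)) else 1)"
      using finite_lower i by simp
    also have "(\<Prod>j\<in>lower l. if j = i then card (carrier (H j)) - 1
        else if j \<in> lower l then card (carrier (H j)) else 1) = (\<Prod>j\<in>lower l. card (carrier (H j)))"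
      using i by (intro prod.cong) auto
    finally show "card (B i) = (\<Prod>j\<in>lower l. card (carrier (H j))) * (card (carrier (H i)) - 1)"
      by (simp add: mult.commute)
  qed simp
  finally show ?thesis by (simp add: sum_distrib_left)
qed

text \<open>Words with supports \<open>K\<close> and \<open>K'\<close> have the same weight, so
  their numbers of moves agree; cancelling the common nonzero product leaves the level sums.\<close>

lemma reflexive_imp_hierarchical:
  assumes refl: "fourier_reflexive \<Omega> H (Q_words \<Omega> H r)"
  shows "hierarchical \<Omega> r"
    and "\<And>u v. u \<in> \<Omega> \<Longrightarrow> v \<in> \<Omega> \<Longrightarrow> chain_len \<Omega> r u = chain_len \<Omega> r v
            \<Longrightarrow> card (carrier (H u)) = card (carrier (H v))"
proof -
  have inv: "(\<Sum>i\<in>level (Suc l) - K. card (carrier (H i)) - 1) = (\<Sum>i\<in>level (Suc l) - K'. card (carrier (H i)) - 1)"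
    if dom: "dominated l" and K: "ideal \<Omega> r K = K" "\<not> K \<subseteq> lower l"
      and K': "ideal \<Omega> r K' = K'" "\<not> K' \<subseteq> lower l" and card: "card K = card K'" for l K K'
  proof -
    have "K \<subseteq> \<Omega>" "K' \<subseteq> \<Omega>" using K(1) K'(1) ideal_ground by blast+
    then obtain \<gamma> \<delta> where \<gamma>: "\<gamma> \<in> words" "supp \<gamma> = K" and \<delta>: "\<delta> \<in> words" "supp \<delta> = K'"
      using ex_word_with_supp by meson
    have wt: "weight \<gamma> = weight \<delta>" using \<gamma> \<delta> K(1) K'(1) card by (simp add: weight_def)
    have "(\<Prod>j\<in>lower l. card (carrier (H j))) * (\<Sum>i\<in>level (Suc l) - K. card (carrier (H i)) - 1)
        = card {\<beta>\<in>words. weight \<beta> = Suc (card (lower l)) \<and> weight (quot \<beta> \<gamma>) = Suc (weight \<gamma>)}"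
      using count_moves[OF dom \<gamma>(1)] \<gamma>(2) K by simp
    also have "\<dots> = card {\<beta>\<in>words. weight \<beta> = Suc (card (lower l)) \<and> weight (quot \<beta> \<delta>) = Suc (weight \<delta>)}"
      unfolding wt by (rule convolution_number_cong[OF refl \<gamma>(1) \<delta>(1) wt])
    also have "\<dots> = (\<Prod>j\<in>lower l. card (carrier (H j))) * (\<Sum>i\<in>level (Suc l) - K'. card (carrier (H i)) - 1)"
      using count_moves[OF dom \<delta>(1)] \<delta>(2) K' by simp
    finally have "(\<Prod>j\<in>lower l. card (carrier (H j))) * (\<Sum>i\<in>level (Suc l) - K. card (carrier (H i)) - 1)
        = (\<Prod>j\<in>lower l. card (carrier (H j))) * (\<Sum>i\<in>level (Suc l) - K'. card (carrier (H i)) - 1)" .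
    moreover have "card (carrier (H j)) \<noteq> 0" if "j \<in> lower l" for j
      using card_H[of j] that by (auto simp: lower_def)
    then have "(\<Prod>j\<in>lower l. card (carrier (H j))) \<noteq> 0" using finite_lower by simp
    ultimately show ?thesis by simp
  qed
  note levels = hierarchical_if_level_sums_invariant[where h = "\<lambda>i. card (carrier (H i))"]
  show "hierarchical \<Omega> r" by (rule levels(1)) (fact card_H, rule inv)
  show "card (carrier (H u)) = card (carrier (H v))"
    if "u \<in> \<Omega>" "v \<in> \<Omega>" "chain_len \<Omega> r u = chain_len \<Omega> r v" for u v
    by (rule levels(2)[OF _ _ that]) (fact card_H, rule inv)
qed

section \<open>Transforms of the weight classes\<close>

lemma class_sum_weight:
  assumes \<alpha>: "\<alpha> \<in> chars"
  shows "class_sum words weight (char_eval \<Omega> \<alpha>) k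
    = (\<Sum>I\<in>ideals_of_card k. ideal_transform (\<lambda>i. of_nat (card (carrier (H i)))) I (supp_char \<Omega> H \<alpha>))"
proof -
  have "class_sum words weight (char_eval \<Omega> \<alpha>) k
     = (\<Sum>I\<in>ideals_of_card k. \<Sum>\<beta> | \<beta> \<in> {\<beta>\<in>words. weight \<beta> = k} \<and> ideal \<Omega> r (supp \<beta>) = I. char_eval \<Omega> \<alpha> \<beta>)"
    unfolding class_sum_def using finite_words finite_ideals_of_card
    by (intro sum.group[symmetric]) (auto simp: ideals_of_card_def weight_def ideal_idem)
  also have "\<dots> = (\<Sum>I\<in>ideals_of_card k. ideal_transform (\<lambda>i. of_nat (card (carrier (H i)))) I (supp_char \<Omega> H \<alpha>))"
  proof (rule sum.cong)
    fix I assume I: "I \<in> ideals_of_card k"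
    have I\<Omega>: "I \<subseteq> \<Omega>" using ideals_of_card_subset I .
    \<comment> \<open>Words generating \<open>I\<close> are nontrivial at its maximal elements,
      arbitrary elsewhere in \<open>I\<close> and trivial outside, so the character sum factors over
      the coordinates.\<close>
    define C where "C i = (if i \<in> top_elements I then carrier (H i) - {\<one>\<^bsub>H i\<^esub>}
      else if i \<in> I then carrier (H i) else {\<one>\<^bsub>H i\<^esub>})" for i
    have topI: "top_elements I \<subseteq> I" by (auto simp: top_elements_def)
    have "{\<beta>. \<beta> \<in> {\<beta>\<in>words. weight \<beta> = k} \<and> ideal \<Omega> r (supp \<beta>) = I} = {\<beta>\<in>words. ideal \<Omega> r (supp \<beta>) = I}"
      using I by (auto simp: ideals_of_card_def weight_def)
    also have "\<dots> = {\<beta>\<in>words. supp \<beta> \<subseteq> I \<and> top_elements I \<subseteq> supp \<beta>}"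
      using I ideal_eq_iff_top_elements[OF _ supp_ground] by (auto simp: ideals_of_card_def)
    also have "\<dots> = (\<Pi>\<^sub>E i\<in>\<Omega>. C i)"
    proof (intro equalityI subsetI)
      fix \<beta> assume "\<beta> \<in> {\<beta>\<in>words. supp \<beta> \<subseteq> I \<and> top_elements I \<subseteq> supp \<beta>}"
      then show "\<beta> \<in> (\<Pi>\<^sub>E i\<in>\<Omega>. C i)"
        unfolding C_def prod_carrier_def supp_word_def PiE_iff by (auto split: if_splits)
    next
      fix \<beta> assume \<beta>: "\<beta> \<in> (\<Pi>\<^sub>E i\<in>\<Omega>. C i)"
      have Ci: "\<beta> i \<in> C i" if "i \<in> \<Omega>" for i using \<beta> that by auto
      have "C i \<subseteq> carrier (H i)" if "i \<in> \<Omega>" for i using one_in_H[OF that] by (auto simp: C_def)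
      then have "\<beta> \<in> words" using \<beta> unfolding prod_carrier_def PiE_iff by blast
      moreover have "supp \<beta> \<subseteq> I" using Ci topI by (force simp: supp_word_def C_def split: if_splits)
      moreover have "top_elements I \<subseteq> supp \<beta>" using Ci topI I\<Omega> by (fastforce simp: supp_word_def C_def)
      ultimately show "\<beta> \<in> {\<beta>\<in>words. supp \<beta> \<subseteq> I \<and> top_elements I \<subseteq> supp \<beta>}" by blast
    qed
    finally have "(\<Sum>\<beta> | \<beta> \<in> {\<beta>\<in>words. weight \<beta> = k} \<and> ideal \<Omega> r (supp \<beta>) = I. char_eval \<Omega> \<alpha> \<beta>)
        = (\<Sum>\<beta>\<in>(\<Pi>\<^sub>E i\<in>\<Omega>. C i). \<Prod>i\<in>\<Omega>. \<alpha> i (\<beta> i))" by (simp add: char_eval_def)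
    also have "\<dots> = (\<Prod>i\<in>\<Omega>. \<Sum>x\<in>C i. \<alpha> i x)"
      using finite_ground finite_H by (intro prod_sum_PiE[symmetric]) (auto simp: C_def)
    also have "\<dots> = (\<Prod>i\<in>\<Omega>. if i \<in> I then (if i \<in> supp_char \<Omega> H \<alpha> then 0 else of_nat (card (carrier (H i))))
        - (if i \<in> top_elements I then 1 else 0) else 1)"
    proof (rule prod.cong)
      fix i assume i: "i \<in> \<Omega>"
      interpret comm_group "H i" using comm_group_H[OF i] .
      have one: "\<alpha> i \<one>\<^bsub>H i\<^esub> = 1" using characters_one[OF chars_mem[OF \<alpha> i]] .
      have tot: "(\<Sum>x\<in>carrier (H i). \<alpha> i x) = (if i \<in> supp_char \<Omega> H \<alpha> then 0 else of_nat (card (carrier (H i))))"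
        using sum_character_over_group[OF chars_mem[OF \<alpha> i]] i by (simp add: supp_char_def)
      have "(\<Sum>x\<in>carrier (H i) - {\<one>\<^bsub>H i\<^esub>}. \<alpha> i x) = (\<Sum>x\<in>carrier (H i). \<alpha> i x) - 1"
        using finite_H[OF i] one by (simp add: sum_diff1)
      then show "(\<Sum>x\<in>C i. \<alpha> i x) = (if i \<in> I then (if i \<in> supp_char \<Omega> H \<alpha> then 0 else of_nat (card (carrier (H i))))
        - (if i \<in> top_elements I then 1 else 0) else 1)"
        using tot one topI by (auto simp: C_def)
    qed simp
    also have "\<dots> = ideal_transform (\<lambda>i. of_nat (card (carrier (H i)))) I (supp_char \<Omega> H \<alpha>)"
      unfolding ideal_transform_def using finite_ground I\<Omega>
      by (intro prod.mono_neutral_cong_right) auto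
    finally show "(\<Sum>\<beta> | \<beta> \<in> {\<beta>\<in>words. weight \<beta> = k} \<and> ideal \<Omega> r (supp \<beta>) = I. char_eval \<Omega> \<alpha> \<beta>)
        = ideal_transform (\<lambda>i. of_nat (card (carrier (H i)))) I (supp_char \<Omega> H \<alpha>)" .
  qed simp
  finally show ?thesis .
qed

lemma hierarchical_imp_dual_eq:
  assumes hier: "hierarchical \<Omega> r"
    and h: "\<And>u v. u \<in> \<Omega> \<Longrightarrow> v \<in> \<Omega> \<Longrightarrow> chain_len \<Omega> r u = chain_len \<Omega> r v
            \<Longrightarrow> card (carrier (H u)) = card (carrier (H v))"
  shows "dual_of_words \<Omega> H (Q_words \<Omega> H r) = Q_chars \<Omega> H (r\<inverse>)"
  unfolding dual_of_words_def Q_words_eq Q_chars_eq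
proof (rule dual_and_bidual(1))
  show "card (dual_weight ` chars) \<le> card (weight ` words)"
    by (simp add: range_weight range_dual_weight)
  interpret graded_poset \<Omega> r "chain_len \<Omega> r"
  proof
    fix u v assume "u \<in> \<Omega>" "v \<in> \<Omega>"
    moreover from this have "chain_len \<Omega> r u + 1 \<le> chain_len \<Omega> r v \<longrightarrow> (u, v) \<in> r"
      using hier unfolding hierarchical_def by blast
    ultimately show "(u, v) \<in> r \<longleftrightarrow> u = v \<or> chain_len \<Omega> r u < chain_len \<Omega> r v"
      using chain_len_strict_mono[of u v] le_refl[of u] by (cases "u = v") (simp, linarith)
  qed
  fix \<alpha> \<alpha>' k assume \<alpha>: "\<alpha> \<in> chars" "\<alpha>' \<in> chars" "dual_weight \<alpha> = dual_weight \<alpha>'"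
  show "class_sum words weight (char_eval \<Omega> \<alpha>) k = class_sum words weight (char_eval \<Omega> \<alpha>') k"
    unfolding class_sum_weight[OF \<alpha>(1)] class_sum_weight[OF \<alpha>(2)]
  proof (rule sum_ideal_transform_cong)
    show "of_nat (card (carrier (H u))) = (of_nat (card (carrier (H v))) :: complex)"
      if "u \<in> \<Omega>" "v \<in> \<Omega>" "chain_len \<Omega> r u = chain_len \<Omega> r v" for u v
      using h[OF that] by simp
    show "card (ideal \<Omega> (r\<inverse>) (supp_char \<Omega> H \<alpha>)) = card (ideal \<Omega> (r\<inverse>) (supp_char \<Omega> H \<alpha>'))"
      using \<alpha>(3) by (simp add: dual_weight_def)
  qed (auto simp: supp_char_def)
qed

text \<open>The assumed equality contains the constancy of the class transforms on dual weight
  classes, from which the bidual is computed.\<close>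

lemma dual_eq_imp_reflexive:
  assumes eq: "dual_of_words \<Omega> H (Q_words \<Omega> H r) = Q_chars \<Omega> H (r\<inverse>)"
  shows "fourier_reflexive \<Omega> H (Q_words \<Omega> H r)"
  unfolding fourier_reflexive_def eq
  unfolding dual_of_chars_def Q_words_eq Q_chars_eq
proof (rule dual_and_bidual(2))
  show "card (dual_weight ` chars) \<le> card (weight ` words)"
    by (simp add: range_weight range_dual_weight)
  fix \<alpha> \<alpha>' k assume "\<alpha> \<in> chars" "\<alpha>' \<in> chars" "dual_weight \<alpha> = dual_weight \<alpha>'" "k \<in> weight ` words"
  then show "class_sum words weight (char_eval \<Omega> \<alpha>) k = class_sum words weight (char_eval \<Omega> \<alpha>') k"
    using eq unfolding dual_of_words_def Q_words_eq Q_chars_eq dual_kernel_partition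
      kernel_partition_eq_iff restrict_eq_iff by blast
qed

end

section \<open>Equivalence of the three conditions\<close>

theorem theorem2p4:
  fixes \<Omega> :: "'i set" and H :: "'i \<Rightarrow> ('a, 'c) monoid_scheme" and r :: "('i \<times> 'i) set"
  assumes "finite \<Omega>"
    and "\<And>i. i \<in> \<Omega> \<Longrightarrow> comm_group (H i)"
    and "\<And>i. i \<in> \<Omega> \<Longrightarrow> finite (carrier (H i))"
    and "\<And>i. i \<in> \<Omega> \<Longrightarrow> card (carrier (H i)) \<ge> 2"
    and "partial_order_on \<Omega> r"
  defines "\<Lambda> \<equiv> dual_of_words \<Omega> H (Q_words \<Omega> H r)"
  shows "(fourier_reflexive \<Omega> H (Q_words \<Omega> H r) \<longleftrightarrow> \<Lambda> = Q_chars \<Omega> H (converse r))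
       \<and> (\<Lambda> = Q_chars \<Omega> H (converse r) \<longleftrightarrow>
            (hierarchical \<Omega> r \<and> (\<forall>u\<in>\<Omega>. \<forall>v\<in>\<Omega>. chain_len \<Omega> r u = chain_len \<Omega> r v
                 \<longrightarrow> card (carrier (H u)) = card (carrier (H v)))))"
proof -
  interpret poset_code \<Omega> r H
    using assms(1-5) by (intro poset_code.intro finite_poset.intro poset_code_axioms.intro)
  \<comment> \<open>The implications form the cycle (1), (3), (2), (1).\<close>
  show ?thesis
    unfolding \<Lambda>_def
    using reflexive_imp_hierarchical hierarchical_imp_dual_eq dual_eq_imp_reflexive by blast
qed

end
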